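(* Let $(n_k)_{k\ge 1}$ be a strictly increasing sequence of positive integers for which there exists an infinite subset $S$ of $\mathbb{N}=\{1,2,\dots\}$ such that $$\sum_{k\in S}\Bigl(\frac{n_k}{n_{k+1}}\Bigr)^2<+\infty\quad\text{and}\quad n_k \mid n_{k+1}\ \text{ for each } k\in\mathbb{N}\setminus S.$$ Then there exists a continuous generalized Riesz product $\sigma$ on $\mathbb{T}$ which is IP-Dirichlet with respect to $(n_k)_{k\ge 1}$.
   Context: $\mathbb{T}=\{\lambda\in\mathbb{C}: |\lambda|=1\}$. For a Borel probability measure $\mu$ on $\mathbb{T}$ and $n\in\mathbb{Z}$, $\hat\mu(n)=\int_{\mathbb{T}}\lambda^n\,d\mu(\lambda)$. A measure is continuous if it has no atoms. Let $\mathcal{F}$ be the set of all non-empty finite subsets of $\mathbb{N}$. A probability measure $\mu$ on $\mathbb{T}$ is IP-Dirichlet with respect to $(n_k)_{k\ge1}$ if $\hat\mu(\sum_{k\in F}n_k)\to 1$ as $\min(F)\to+\infty$, $F\in\mathcal{F}$; that is, for every $\varepsilon>0$ there exists $k_0$ such that $|\hat\mu(\sum_{k\in F}n_k)-1|<\varepsilon$ for every $F\in\mathcal{F}$ with $\min(F)\ge k_0$. A generalized Riesz product on $\mathbb{T}$ is a probability measure that is the weak-$*$ limit, as $N\to+\infty$, of the measures $\prod_{k=1}^N P_k(\lambda^{a_k})\,dm(\lambda)$, where $m$ is the normalized Lebesgue measure on $\mathbb{T}$, each $P_k$ is a trigonometric polynomial of degree $d_k$ (spectrum contained in $\{-d_k,\dots,d_k\}$)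 which is nonnegative on $\mathbb{T}$ and has constant Fourier coefficient $\hat P_k(0)=1$, and $(a_k)_{k\ge1}$ is a strictly increasing sequence of positive integers satisfying the dissociation condition $a_{k+1}-2\sum_{j=1}^k d_ja_j\ge 1$ for each $k\ge1$. *)

theory Defs
  imports "HOL-Probability.Probability"
begin

definition circle_borel :: "complex measure" where
  "circle_borel = restrict_space borel (sphere 0 1)"

definition circle_prob :: "complex measure \<Rightarrow> bool" where
  "circle_prob \<mu> \<longleftrightarrow> prob_space \<mu> \<and> sets \<mu> = sets circle_borel"

text \<open>Normalized Lebesgue measure on the circle.\<close>
definition circle_lebesgue :: "complex measure" where
  "circle_lebesgue = distr (uniform_measure lborel {0..2 * pi}) circle_borel cis"

text \<open>The sign convention is \<open>z\<^sup>n\<close>, not \<open>z\<^sup>-\<^sup>n\<close>.\<close>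
definition fourier_coeff :: "complex measure \<Rightarrow> int \<Rightarrow> complex" where
  "fourier_coeff \<mu> n = (LINT z|\<mu>. z powi n)"

definition continuous_measure :: "complex measure \<Rightarrow> bool" where
  "continuous_measure \<mu> \<longleftrightarrow> (\<forall>z\<in>space \<mu>. emeasure \<mu> {z} = 0)"

text \<open>Sequences indexed by the positive integers are functions on \<^typ>\<open>nat\<close> whose value at \<open>0\<close>
  is irrelevant.\<close>
definition IP_Dirichlet :: "complex measure \<Rightarrow> (nat \<Rightarrow> nat) \<Rightarrow> bool" where
  "IP_Dirichlet \<mu> n \<longleftrightarrow>
     (\<forall>\<epsilon>>0. \<exists>k0. \<forall>F. finite F \<and> F \<noteq> {} \<and> F \<subseteq> {1..} \<and> Min F \<ge> k0 \<longrightarrow>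
        cmod (fourier_coeff \<mu> (int (\<Sum>k\<in>F. n k)) - 1) < \<epsilon>)"

text \<open>A trigonometric polynomial with spectrum in \<open>{-d..d}\<close> is given by its Fourier
  coefficients \<open>c\<close>; the values of \<open>c\<close> outside this range are ignored.\<close>
definition trig_poly :: "nat \<Rightarrow> (int \<Rightarrow> complex) \<Rightarrow> complex \<Rightarrow> complex" where
  "trig_poly d c z = (\<Sum>j\<in>{- int d..int d}. c j * z powi j)"

text \<open>Weak-* convergence of measures on the circle, tested against all continuous functions.\<close>
definition circle_weak_star_limit :: "(nat \<Rightarrow> complex measure) \<Rightarrow> complex measure \<Rightarrow> bool" where
  "circle_weak_star_limit \<mu>s \<mu> \<longleftrightarrow>
     (\<forall>f :: complex \<Rightarrow> complex. continuous_on (sphere 0 1) f \<longrightarrow>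
        (\<lambda>N. LINT z|\<mu>s N. f z) \<longlonglongrightarrow> (LINT z|\<mu>. f z))"

text \<open>The real part only serves to convert the product to a real-valued density: it is applied
  below to factors that are real and nonnegative on the circle.\<close>
definition riesz_partial ::
    "(nat \<Rightarrow> nat) \<Rightarrow> (nat \<Rightarrow> int \<Rightarrow> complex) \<Rightarrow> (nat \<Rightarrow> nat) \<Rightarrow> nat \<Rightarrow> complex measure" where
  "riesz_partial d c a N =
     density circle_lebesgue (\<lambda>z. ennreal (Re (\<Prod>k=1..N. trig_poly (d k) (c k) (z ^ a k))))"

definition generalized_riesz_product :: "complex measure \<Rightarrow> bool" where
  "generalized_riesz_product \<sigma> \<longleftrightarrow> circle_prob \<sigma> \<and>
     (\<exists>(d :: nat \<Rightarrow> nat) (c :: nat \<Rightarrow> int \<Rightarrow> complex) (a :: nat \<Rightarrow> nat).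
        (\<forall>k\<ge>1. (\<forall>z\<in>sphere 0 1. trig_poly (d k) (c k) z \<in> \<real>\<^sub>\<ge>\<^sub>0) \<and> c k 0 = 1) \<and>
        strict_mono_on {1..} a \<and> (\<forall>k\<ge>1. a k > 0) \<and>
        (\<forall>k\<ge>1. int (a (Suc k)) - 2 * (\<Sum>j=1..k. int (d j) * int (a j)) \<ge> 1) \<and>
        circle_weak_star_limit (riesz_partial d c a) \<sigma>)"

text \<open>\<^const>\<open>distr\<close> is only meaningful for measurable maps; this confirms that
  \<^const>\<open>circle_lebesgue\<close> is a Borel probability measure on the circle.\<close>
lemma circle_prob_lebesgue: "circle_prob circle_lebesgue"
proof -
  have "cis \<in> borel_measurable borel"
    by (intro borel_measurable_continuous_onI continuous_intros)
  then have "cis \<in> uniform_measure lborel {0..2 * pi} \<rightarrow>\<^sub>M circle_borel"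
    unfolding circle_borel_def by (intro measurable_restrict_space2) auto
  moreover have "prob_space (uniform_measure lborel {0..2 * pi})"
    by (rule prob_space_uniform_measure) auto
  ultimately show ?thesis
    unfolding circle_prob_def circle_lebesgue_def by (auto intro: prob_space.prob_space_distr)
qed

end

theory Submission
  imports Defs
begin

text \<open>
  Cut the indices after each element of \<open>S\<close>. Within a block every \<open>n\<^sub>k\<close> is a multiple of the first
  term \<open>a\<^sub>i\<close> of the block, and the sum of a block is at most twice its last term \<open>b\<^sub>i\<close>, so that
  \<open>\<Sum>k\<in>F. n\<^sub>k = \<Sum>i. m\<^sub>i a\<^sub>i\<close> with \<open>0 \<le> m\<^sub>i \<le> 2 b\<^sub>i / a\<^sub>i\<close>. Let \<open>P\<^sub>i\<close> be a Jackson kernel of degree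
  \<open>d\<^sub>i = \<lfloor>a\<^sub>i\<^sub>+\<^sub>1 / (4 a\<^sub>i)\<rfloor>\<close>; its Fourier
  coefficients satisfy \<open>1 - P\<^sub>i(m) = O((m / (d\<^sub>i + 1))\<^sup>2)\<close>. By dissociation the
  Fourier coefficient of the Riesz product at \<open>\<Sum>i. m\<^sub>i a\<^sub>i\<close> is the product of the \<open>P\<^sub>i(m\<^sub>i)\<close>, so it
  differs from 1 by \<open>O(\<Sum>i. (b\<^sub>i / a\<^sub>i\<^sub>+\<^sub>1)\<^sup>2)\<close>, a tail of a convergent series. The spectrum is so sparse
  (at most \<open>\<Prod>j\<le>k. (2 d\<^sub>j + 1) = o(a\<^sub>k\<^sub>+\<^sub>1)\<close> frequencies up to \<open>a\<^sub>k\<^sub>+\<^sub>1 / 2\<close>) that the Fourier coefficients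
  tend to 0 in mean, which excludes atoms. The weak-* limit exists because each Fourier coefficient
  of the partial products is eventually constant.
\<close>

section \<open>Weak-* limits of probability measures on the circle\<close>

lemma circle_prob_space:
  assumes "circle_prob \<mu>"
  shows "space \<mu> = sphere 0 1"
proof -
  have "sets \<mu> = sets circle_borel"
    using assms by (simp add: circle_prob_def)
  then have "space \<mu> = space circle_borel"
    by (rule sets_eq_imp_space_eq)
  then show ?thesis
    by (simp add: circle_borel_def space_restrict_space)
qed

lemma circle_prob_measurable:
  assumes "circle_prob \<mu>" and "continuous_on (sphere 0 1) f"
  shows "f \<in> borel_measurable \<mu>"
proof -
  have "f \<in> borel_measurable circle_borel"
    unfolding circle_borel_def using assms(2) by (rule borel_measurable_continuous_on_restrict)
  moreover have "sets \<mu> = sets circle_borel"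
    using assms(1) by (simp add: circle_prob_def)
  ultimately show ?thesis
    by (simp cong: measurable_cong_sets)
qed

lemma continuous_on_circle_bounded:
  fixes f :: "complex \<Rightarrow> 'a::real_normed_vector"
  assumes "continuous_on (sphere 0 1) f"
  obtains B where "\<And>z. z \<in> sphere 0 1 \<Longrightarrow> norm (f z) \<le> B"
proof -
  have "compact (f ` sphere 0 1)"
    using assms by (intro compact_continuous_image) auto
  then have "bounded (f ` sphere 0 1)"
    by (rule compact_imp_bounded)
  then show ?thesis
    unfolding bounded_iff using that by blast
qed

lemma circle_prob_integrable:
  fixes f :: "complex \<Rightarrow> complex"
  assumes "circle_prob \<mu>" and "continuous_on (sphere 0 1) f"
  shows "integrable \<mu> f"
proof -
  interpret prob_space \<mu>
    using assms(1) by (simp add: circle_prob_def)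
  obtain B where "\<And>z. z \<in> sphere 0 1 \<Longrightarrow> norm (f z) \<le> B"
    using continuous_on_circle_bounded[OF assms(2)] by blast
  then show ?thesis
    using circle_prob_space[OF assms(1)] circle_prob_measurable[OF assms]
    by (intro integrable_const_bound[of _ B]) auto
qed

lemma circle_prob_norm_integral_le:
  fixes f :: "complex \<Rightarrow> complex"
  assumes "circle_prob \<mu>" and "\<And>z. z \<in> sphere 0 1 \<Longrightarrow> norm (f z) \<le> B" and "B \<ge> 0"
  shows "norm (LINT z|\<mu>. f z) \<le> B"
proof -
  interpret prob_space \<mu>
    using assms(1) by (simp add: circle_prob_def)
  have "norm (LINT z|\<mu>. f z) \<le> (LINT z|\<mu>. norm (f z))"
    by (rule integral_norm_bound)
  also have "\<dots> \<le> (LINT z|\<mu>. B)"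
    by (rule Bochner_Integration.integral_mono')
      (use assms circle_prob_space[OF assms(1)] in \<open>auto\<close>)
  also have "\<dots> = B"
    by (simp add: prob_space)
  finally show ?thesis .
qed

section \<open>Laurent polynomials and their density in the continuous functions on the
  circle\<close>

lemma continuous_on_circle_power_int: "continuous_on (sphere 0 1) (\<lambda>z::complex. z powi n)"
  by (intro continuous_intros) auto

text \<open>Generated by monomials and sums, so that statements linear in the function, such as
  convergence of integrals, follow by induction.\<close>

inductive laurent_poly :: "(complex \<Rightarrow> complex) \<Rightarrow> bool" where
  monom: "laurent_poly (\<lambda>z. c * z powi n)"
| add: "laurent_poly f \<Longrightarrow> laurent_poly g \<Longrightarrow> laurent_poly (\<lambda>z. f z + g z)"

lemma laurent_poly_continuous_on:
  assumes "laurent_poly f"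
  shows "continuous_on (sphere 0 1) f"
  using assms by induction (auto intro!: continuous_intros)

text \<open>Equality is claimed on the circle only: at \<open>0\<close> the rule for adding
  exponents of \<open>powi\<close> can fail.\<close>

lemma laurent_poly_mult:
  assumes "laurent_poly f" and "laurent_poly g"
  obtains h where "laurent_poly h" "\<And>z. z \<in> sphere 0 1 \<Longrightarrow> h z = f z * g z"
proof -
  have monom_mult: "\<exists>h. laurent_poly h \<and> (\<forall>z\<in>sphere 0 1. h z = c * z powi n * g z)" for c n
    using assms(2)
  proof induction
    case (monom c' n')
    have "laurent_poly (\<lambda>z. (c * c') * z powi (n + n'))"
      by (rule laurent_poly.monom)
    moreover have "(c * c') * z powi (n + n') = c * z powi n * (c' * z powi n')"
      if "z \<in> sphere 0 1" for z
      using that by (subst power_int_add) auto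
    ultimately show ?case
      by blast
  next
    case (add f g)
    then obtain h1 h2 where "laurent_poly h1" "laurent_poly h2"
      "\<forall>z\<in>sphere 0 1. h1 z = c * z powi n * f z" "\<forall>z\<in>sphere 0 1. h2 z = c * z powi n * g z"
      by blast
    then show ?case
      by (intro exI[of _ "\<lambda>z. h1 z + h2 z"]) (auto intro: laurent_poly.add simp: algebra_simps)
  qed
  from assms(1) have "\<exists>h. laurent_poly h \<and> (\<forall>z\<in>sphere 0 1. h z = f z * g z)"
  proof induction
    case (monom c n)
    then show ?case by (rule monom_mult)
  next
    case (add f f')
    then obtain h1 h2 where "laurent_poly h1" "laurent_poly h2"
      "\<forall>z\<in>sphere 0 1. h1 z = f z * g z" "\<forall>z\<in>sphere 0 1. h2 z = f' z * g z"
      by blast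
    then show ?case
      by (intro exI[of _ "\<lambda>z. h1 z + h2 z"]) (auto intro: laurent_poly.add simp: algebra_simps)
  qed
  with that show ?thesis by blast
qed

text \<open>On the circle \<open>cnj z\<close> equals \<open>z powi (- 1)\<close>, so a real-linear
  functional of \<open>z\<close> is a combination of \<open>z\<close> and its inverse; sums and
  products preserve the class.\<close>

lemma real_polynomial_function_laurent_poly:
  assumes "real_polynomial_function p"
  obtains h where "laurent_poly h" "\<And>z. z \<in> sphere 0 1 \<Longrightarrow> h z = complex_of_real (p z)"
proof -
  from assms have "\<exists>h. laurent_poly h \<and> (\<forall>z\<in>sphere 0 1. h z = complex_of_real (p z))"
  proof induction
    case (linear p)
    then interpret bounded_linear p .
    \<comment> \<open>Chosen so that \<open>\<alpha> * z + cnj \<alpha> * cnj z\<close>, which is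
      twice the real part of \<open>\<alpha> * z\<close>, equals
      \<open>Re z * p 1 + Im z * p \<i>\<close>.\<close>
    define \<alpha> where "\<alpha> = (complex_of_real (p 1) - \<i> * complex_of_real (p \<i>)) / 2"
    have "laurent_poly (\<lambda>z. \<alpha> * z powi 1 + cnj \<alpha> * z powi (- 1))"
      by (intro laurent_poly.intros)
    moreover have "\<alpha> * z powi 1 + cnj \<alpha> * z powi (- 1) = complex_of_real (p z)"
      if "z \<in> sphere 0 1" for z
    proof -
      have "cmod z = 1"
        using that by simp
      then have "inverse z = cnj z"
        by (metis complex_mod_mult_cnj divide_complex_def inverse_eq_divide inverse_unique
            complex_norm_square of_real_1 power_one)
      then have "z powi (- 1) = cnj z"
        by (simp add: power_int_minus)
      moreover have "p z = Re z * p 1 + Im z * p \<i>"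
      proof -
        have "z = Re z *\<^sub>R 1 + Im z *\<^sub>R \<i>"
          by (simp add: complex_eq_iff)
        then have "p z = p (Re z *\<^sub>R 1 + Im z *\<^sub>R \<i>)"
          by simp
        also have "\<dots> = Re z * p 1 + Im z * p \<i>"
          by (simp only: add scaleR real_scaleR_def)
        finally show ?thesis .
      qed
      ultimately show ?thesis
        by (simp only: \<alpha>_def) (simp add: complex_eq_iff field_simps)
    qed
    ultimately show ?case
      by blast
  next
    case (const c)
    have "laurent_poly (\<lambda>z. complex_of_real c * z powi 0)"
      by (rule laurent_poly.monom)
    then show ?case
      by (intro exI[of _ "\<lambda>z. complex_of_real c * z powi 0"]) auto
  next
    case (add f g)
    then obtain h1 h2 where "laurent_poly h1" "laurent_poly h2"
      "\<forall>z\<in>sphere 0 1. h1 z = complex_of_real (f z)" "\<forall>z\<in>sphere 0 1. h2 z = complex_of_real (g z)"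
      by blast
    then show ?case
      by (intro exI[of _ "\<lambda>z. h1 z + h2 z"]) (auto intro: laurent_poly.add)
  next
    case (mult f g)
    then obtain h1 h2 where h: "laurent_poly h1" "laurent_poly h2"
      "\<forall>z\<in>sphere 0 1. h1 z = complex_of_real (f z)" "\<forall>z\<in>sphere 0 1. h2 z = complex_of_real (g z)"
      by blast
    obtain h where "laurent_poly h" "\<And>z. z \<in> sphere 0 1 \<Longrightarrow> h z = h1 z * h2 z"
      using laurent_poly_mult[OF h(1,2)] by blast
    with h show ?case
      by (intro exI[of _ h]) auto
  qed
  with that show ?thesis by blast
qed

text \<open>Stone-Weierstrass gives an approximation by a polynomial in the real coordinates; its
  real and imaginary parts are Laurent polynomials on the circle.\<close>

lemma laurent_poly_approx:
  fixes f :: "complex \<Rightarrow> complex"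
  assumes "continuous_on (sphere 0 1) f" and "\<epsilon> > 0"
  obtains h where "laurent_poly h" "\<And>z. z \<in> sphere 0 1 \<Longrightarrow> norm (f z - h z) < \<epsilon>"
proof -
  obtain g where g: "polynomial_function g" "\<And>z. z \<in> sphere 0 1 \<Longrightarrow> norm (f z - g z) < \<epsilon>"
    using Stone_Weierstrass_polynomial_function[OF compact_sphere assms] by blast
  have re: "real_polynomial_function (Re \<circ> g)" and im: "real_polynomial_function (Im \<circ> g)"
    using g(1) bounded_linear_Re bounded_linear_Im by (auto simp: polynomial_function_def)
  obtain h1 where h1: "laurent_poly h1" "\<And>z. z \<in> sphere 0 1 \<Longrightarrow> h1 z = complex_of_real ((Re \<circ> g) z)"
    using real_polynomial_function_laurent_poly[OF re] by blast
  obtain h2 where h2: "laurent_poly h2" "\<And>z. z \<in> sphere 0 1 \<Longrightarrow> h2 z = complex_of_real ((Im \<circ> g) z)"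
    using real_polynomial_function_laurent_poly[OF im] by blast
  obtain h3 where h3: "laurent_poly h3" "\<And>z. z \<in> sphere 0 1 \<Longrightarrow> h3 z = (\<i> * z powi 0) * h2 z"
    using laurent_poly_mult[OF laurent_poly.monom h2(1)] by blast
  have "h1 z + h3 z = g z" if "z \<in> sphere 0 1" for z
    using that h1(2) h2(2) h3(2) by (simp add: complex_eq_iff)
  then show ?thesis
    using that[OF laurent_poly.add[OF h1(1) h3(1)]] g(2) by metis
qed

section \<open>Transfer between the circle and the real line; existence of weak-* limits\<close>

lemma cis_measurable_circle: "cis \<in> borel \<rightarrow>\<^sub>M circle_borel"
proof -
  have "cis \<in> borel_measurable borel"
    by (intro borel_measurable_continuous_onI continuous_intros)
  then show ?thesis
    unfolding circle_borel_def by (intro measurable_restrict_space2) auto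
qed

text \<open>\<open>Arg\<close> is continuous off the nonpositive real axis, which meets the circle
  only at \<open>-1\<close>, where the value is \<open>pi\<close>.\<close>

lemma Arg_measurable_circle: "Arg \<in> borel_measurable circle_borel"
proof -
  have "(\<lambda>z. if z \<in> - \<real>\<^sub>\<le>\<^sub>0 then Arg z else pi) \<in> borel_measurable borel"
    by (rule borel_measurable_continuous_on_if) (auto intro: continuous_on_Arg)
  then have "(\<lambda>z. if z \<in> - \<real>\<^sub>\<le>\<^sub>0 then Arg z else pi) \<in> borel_measurable circle_borel"
    unfolding circle_borel_def by (rule measurable_restrict_space1)
  moreover have "Arg z = (if z \<in> - \<real>\<^sub>\<le>\<^sub>0 then Arg z else pi)" if "z \<in> space circle_borel" for z
  proof -
    have "z \<noteq> 0"
      using that by (auto simp: circle_borel_def space_restrict_space)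
    then show ?thesis
      by (auto simp: Arg_eq_pi complex_nonpos_Reals_iff complex_eq_iff)
  qed
  ultimately show ?thesis
    by (simp cong: measurable_cong)
qed

text \<open>The measures are lifted to the line by \<open>Arg\<close>, a weakly convergent
  subsequence is selected there, and its limit is carried back by \<open>cis\<close>. Convergence of
  every Fourier coefficient, with density of Laurent polynomials, upgrades this to the whole
  sequence.\<close>

theorem circle_weak_star_limit_exists:
  assumes prob: "\<And>N. circle_prob (\<mu> N)"
    and conv: "\<And>n. convergent (\<lambda>N. fourier_coeff (\<mu> N) n)"
  obtains \<sigma> where "circle_prob \<sigma>" "circle_weak_star_limit \<mu> \<sigma>"
proof -
  interpret \<mu>: prob_space "\<mu> N" for N
    using prob by (simp add: circle_prob_def)
  define \<nu> where "\<nu> N = distr (\<mu> N) borel Arg" for N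
  have Arg [measurable]: "Arg \<in> borel_measurable (\<mu> N)" for N
    using Arg_measurable_circle prob[of N]
    by (simp add: circle_prob_def cong: measurable_cong_sets)
  have real_dist: "real_distribution (\<nu> N)" for N
  proof -
    interpret prob_space "\<nu> N"
      unfolding \<nu>_def by (intro \<mu>.prob_space_distr) simp
    show ?thesis
      by unfold_locales (simp add: \<nu>_def)
  qed
  have "tight \<nu>"
    unfolding tight_def
  proof (intro conjI allI impI)
    fix \<epsilon> :: real
    assume "\<epsilon> > 0"
    \<comment> \<open>\<open>Arg\<close> takes values between \<open>- pi\<close> and
      \<open>pi\<close>, so one bounded interval carries all the mass.\<close>
    have "measure (\<nu> N) {- 4<..4} = 1" for N
    proof -
      have "measure (\<nu> N) {- 4<..4} = measure (\<mu> N) (Arg -` {- 4<..4} \<inter> space (\<mu> N))"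
        unfolding \<nu>_def by (rule measure_distr) auto
      also have "Arg -` {- 4<..4} \<inter> space (\<mu> N) = space (\<mu> N)"
        using Arg_bounded pi_less_4 by (auto intro: order_trans less_le_trans)
           (smt (verit))+
      finally show ?thesis
        by (simp add: \<mu>.prob_space)
    qed
    then show "\<exists>a b. a < b \<and> (\<forall>N. 1 - \<epsilon> < measure (\<nu> N) {a<..b})"
      using \<open>\<epsilon> > 0\<close> by (intro exI[of _ "- 4"] exI[of _ 4]) auto
  qed (rule real_dist)
  then obtain r M where r: "strict_mono (r :: nat \<Rightarrow> nat)" and M: "real_distribution M"
    and weak: "weak_conv_m (\<nu> \<circ> id \<circ> r) M"
    using tight_imp_convergent_subsubsequence[of \<nu> id] strict_mono_id by blast
  interpret M: real_distribution M by (rule M)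
  have cis_M [measurable]: "cis \<in> M \<rightarrow>\<^sub>M circle_borel"
    using cis_measurable_circle by (simp cong: measurable_cong_sets)
  define \<sigma> where "\<sigma> = distr M circle_borel cis"
  have \<sigma>: "circle_prob \<sigma>"
    unfolding circle_prob_def \<sigma>_def by (simp add: M.prob_space_distr)
  \<comment> \<open>The jump of \<open>Arg\<close> does no harm: the test function on the line is
    \<open>f (cis t)\<close>, which is continuous and bounded, and \<open>cis (Arg z) = z\<close> on
    the circle.\<close>
  have subseq: "(\<lambda>N. LINT z|\<mu> (r N). f z) \<longlonglongrightarrow> (LINT z|\<sigma>. f z)"
    if f: "continuous_on (sphere 0 1) f" for f :: "complex \<Rightarrow> complex"
  proof -
    obtain B where B: "\<And>z. z \<in> sphere 0 1 \<Longrightarrow> norm (f z) \<le> B"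
      using continuous_on_circle_bounded[OF f] by blast
    have fcis: "continuous_on UNIV (\<lambda>t. f (cis t))"
      using f by (rule continuous_on_compose2) (auto intro: continuous_on_cis)
    then have meas: "(\<lambda>t. f (cis t)) \<in> borel_measurable borel"
      by (rule borel_measurable_continuous_onI)
    have "(\<lambda>N. LINT t|(\<nu> \<circ> id \<circ> r) N. f (cis t)) \<longlonglongrightarrow> (LINT t|M. f (cis t))"
    proof (rule weak_conv_imp_integral_bdd_continuous_conv[OF _ _ weak, where B = B])
      show "isCont (\<lambda>t. f (cis t)) x" for x
        using fcis by (simp add: continuous_on_eq_continuous_at)
    qed (use real_dist M B in auto)
    moreover have "(LINT t|(\<nu> \<circ> id \<circ> r) N. f (cis t)) = (LINT z|\<mu> (r N). f z)" for N
    proof -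
      have "(LINT t|(\<nu> \<circ> id \<circ> r) N. f (cis t)) = (LINT z|\<mu> (r N). f (cis (Arg z)))"
        unfolding \<nu>_def comp_def id_def by (rule integral_distr) (use meas in auto)
      also have "\<dots> = (LINT z|\<mu> (r N). f z)"
      proof (rule Bochner_Integration.integral_cong)
        fix z
        assume "z \<in> space (\<mu> (r N))"
        then have "cmod z = 1"
          using circle_prob_space[OF prob] by simp
        then show "f (cis (Arg z)) = f z"
          by (cases "z = 0") (auto simp: cis_Arg sgn_eq)
      qed simp
      finally show ?thesis .
    qed
    moreover have "(LINT t|M. f (cis t)) = (LINT z|\<sigma>. f z)"
      unfolding \<sigma>_def
      by (rule integral_distr[symmetric, OF cis_M])
        (use f in \<open>auto simp: circle_borel_def intro: borel_measurable_continuous_on_restrict\<close>)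
    ultimately show ?thesis
      by simp
  qed
  have powers: "(\<lambda>N. LINT z|\<mu> N. z powi n) \<longlonglongrightarrow> (LINT z|\<sigma>. z powi n)" for n
  proof -
    obtain L where L: "(\<lambda>N. LINT z|\<mu> N. z powi n) \<longlonglongrightarrow> L"
      using conv[of n] unfolding convergent_def fourier_coeff_def by blast
    then have "(\<lambda>N. LINT z|\<mu> (r N). z powi n) \<longlonglongrightarrow> L"
      using LIMSEQ_subseq_LIMSEQ[OF L r] by (simp add: comp_def)
    \<comment> \<open>The full sequence has a limit by \<open>conv\<close>, and the subsequence
      identifies it.\<close>
    then have "L = (LINT z|\<sigma>. z powi n)"
      using subseq[OF continuous_on_circle_power_int] by (rule LIMSEQ_unique)
    with L show ?thesis
      by simp
  qed
  have laurent: "(\<lambda>N. LINT z|\<mu> N. h z) \<longlonglongrightarrow> (LINT z|\<sigma>. h z)" if "laurent_poly h" for h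
    using that
  proof induction
    case (monom c n)
    show ?case
      using tendsto_mult_left[OF powers] by simp
  next
    case (add f g)
    have "(LINT z|\<tau>. f z + g z) = (LINT z|\<tau>. f z) + (LINT z|\<tau>. g z)" if "circle_prob \<tau>" for \<tau>
      using add.hyps that
      by (intro Bochner_Integration.integral_add circle_prob_integrable laurent_poly_continuous_on)
    then show ?case
      using tendsto_add[OF add.IH] prob \<sigma> by simp
  qed
  have "(\<lambda>N. LINT z|\<mu> N. f z) \<longlonglongrightarrow> (LINT z|\<sigma>. f z)"
    if f: "continuous_on (sphere 0 1) f" for f :: "complex \<Rightarrow> complex"
  proof (rule LIMSEQ_I)
    fix \<epsilon> :: real
    assume \<epsilon>: "\<epsilon> > 0"
    obtain h where h: "laurent_poly h" "\<And>z. z \<in> sphere 0 1 \<Longrightarrow> norm (f z - h z) < \<epsilon> / 3"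
      using laurent_poly_approx[OF f, of "\<epsilon> / 3"] \<epsilon> by auto
    have close: "norm ((LINT z|\<tau>. f z) - (LINT z|\<tau>. h z)) \<le> \<epsilon> / 3" if "circle_prob \<tau>" for \<tau>
    proof -
      have "(LINT z|\<tau>. f z) - (LINT z|\<tau>. h z) = (LINT z|\<tau>. f z - h z)"
        using f that laurent_poly_continuous_on[OF h(1)]
        by (intro Bochner_Integration.integral_diff[symmetric] circle_prob_integrable)
      also have "norm \<dots> \<le> \<epsilon> / 3"
        using h(2) \<epsilon> that by (intro circle_prob_norm_integral_le) (auto intro: less_imp_le)
      finally show ?thesis .
    qed
    obtain N0 where "\<And>N. N \<ge> N0 \<Longrightarrow> norm ((LINT z|\<mu> N. h z) - (LINT z|\<sigma>. h z)) < \<epsilon> / 3"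
      using LIMSEQ_D[OF laurent[OF h(1)], of "\<epsilon> / 3"] \<epsilon> by auto
    moreover have "norm (x - y) < \<epsilon>"
      if "norm (x - x') \<le> \<epsilon> / 3" "norm (y - y') \<le> \<epsilon> / 3" "norm (x' - y') < \<epsilon> / 3"
      for x y x' y' :: complex
      using that dist_triangle[of x y x'] dist_triangle[of x' y y'] dist_commute[of y y']
      by (simp add: dist_norm)
    ultimately show "\<exists>N0. \<forall>N\<ge>N0. norm ((LINT z|\<mu> N. f z) - (LINT z|\<sigma>. f z)) < \<epsilon>"
      using close[OF prob] close[OF \<sigma>] by blast
  qed
  then show ?thesis
    using that \<sigma> by (auto simp: circle_weak_star_limit_def)
qed

section \<open>Fourier coefficients of Riesz products\<close>

lemma circle_lebesgue_power_int:
  "(LINT z|circle_lebesgue. z powi n) = (if n = 0 then 1 else 0)"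
proof (cases "n = 0")
  case True
  interpret prob_space circle_lebesgue
    using circle_prob_lebesgue by (simp add: circle_prob_def)
  show ?thesis
    using True by (simp add: prob_space)
next
  case False
  have "(LINT z|circle_lebesgue. z powi n)
      = (LINT t|uniform_measure lborel {0..2 * pi}. cis t powi n)"
    unfolding circle_lebesgue_def
  proof (rule integral_distr)
    show "cis \<in> uniform_measure lborel {0..2 * pi} \<rightarrow>\<^sub>M circle_borel"
      using cis_measurable_circle by (simp cong: measurable_cong_sets)
    show "(\<lambda>z. z powi n) \<in> borel_measurable circle_borel"
      unfolding circle_borel_def
      by (rule borel_measurable_continuous_on_restrict[OF continuous_on_circle_power_int])
  qed
  also have "uniform_measure lborel {0..2 * pi}
      = density lborel (\<lambda>t. ennreal (indicator {0..2 * pi} t / (2 * pi)))"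
  proof -
    have "indicator {0..2 * pi} t / emeasure lborel {0..2 * pi}
        = ennreal (indicator {0..2 * pi} t / (2 * pi))" for t :: real
      by (simp add: indicator_def divide_ennreal flip: ennreal_1)
    then show ?thesis
      unfolding uniform_measure_def by simp
  qed
  also have "(LINT t|density lborel (\<lambda>t. ennreal (indicator {0..2 * pi} t / (2 * pi))). cis t powi n)
      = (LINT t|lborel. (indicator {0..2 * pi} t / (2 * pi)) *\<^sub>R (cis t powi n))"
  proof (rule integral_density)
    have "continuous_on UNIV (\<lambda>t. cis t powi n)"
      by (intro continuous_intros) auto
    then show "(\<lambda>t. cis t powi n) \<in> borel_measurable lborel"
      using borel_measurable_continuous_onI by auto
  qed auto
  also have "\<dots> = (LINT t|lborel. indicator {0..2 * pi} t *\<^sub>R (cis (of_int n * t) / (2 * pi)))"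
    by (intro Bochner_Integration.integral_cong)
      (auto simp: cis_power_int indicator_def scaleR_conv_of_real)
  also have "\<dots> = cis (of_int n * (2 * pi)) / (\<i> * of_int n * (2 * pi)) - cis (of_int n * 0) / (\<i> * of_int n * (2 * pi))"
  proof (rule integral_FTC_Icc)
    fix t :: real
    have "((\<lambda>w. exp (\<i> * of_int n * w) / (\<i> * of_int n * (2 * pi))) has_field_derivative
        exp (\<i> * of_int n * of_real t) / (2 * pi)) (at (of_real t))"
      using False by (auto intro!: derivative_eq_intros simp: field_simps)
    then have "((\<lambda>t. exp (\<i> * of_int n * of_real t) / (\<i> * of_int n * (2 * pi)))
        has_vector_derivative exp (\<i> * of_int n * of_real t) / (2 * pi)) (at t within {0..2 * pi})"
      by (rule has_vector_derivative_real_field)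
    then show "((\<lambda>t. cis (of_int n * t) / (\<i> * of_int n * (2 * pi))) has_vector_derivative
        cis (of_int n * t) / (2 * pi)) (at t within {0..2 * pi})"
      by (simp add: cis_conv_exp mult.assoc)
  qed (auto intro!: continuous_intros)
  also have "\<dots> = 0"
    using cis_multiple_2pi[of "of_int n"] by (simp add: mult_ac)
  finally show ?thesis
    using False by simp
qed

section \<open>Recursion, stability and support of the coefficients of dissociated products\<close>

locale dissociated_riesz =
  fixes d :: "nat \<Rightarrow> nat" and c :: "nat \<Rightarrow> int \<Rightarrow> complex" and a :: "nat \<Rightarrow> nat"
  assumes nonneg: "k \<ge> 1 \<Longrightarrow> z \<in> sphere 0 1 \<Longrightarrow> trig_poly (d k) (c k) z \<in> \<real>\<^sub>\<ge>\<^sub>0"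
    and c_0: "k \<ge> 1 \<Longrightarrow> c k 0 = 1"
    and mono: "strict_mono_on {1..} a"
    and a_pos: "k \<ge> 1 \<Longrightarrow> a k > 0"
    and dissociate: "k \<ge> 1 \<Longrightarrow> int (a (Suc k)) - 2 * (\<Sum>j=1..k. int (d j) * int (a j)) \<ge> 1"
begin

definition riesz_density :: "nat \<Rightarrow> complex \<Rightarrow> complex" where
  "riesz_density N z = (\<Prod>k=1..N. trig_poly (d k) (c k) (z ^ a k))"

definition deg :: "nat \<Rightarrow> int" where
  "deg N = (\<Sum>j=1..N. int (d j) * int (a j))"

text \<open>Integration is against \<open>z powi n\<close>, so this is the usual coefficient of the
  density at \<open>- n\<close>; hence the sign in \<open>c k (- m)\<close> below.\<close>

definition coeff :: "nat \<Rightarrow> int \<Rightarrow> complex" where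
  "coeff N n = (LINT z|circle_lebesgue. z powi n * riesz_density N z)"

lemma deg_0: "deg 0 = 0"
  by (simp add: deg_def)

lemma deg_Suc: "deg (Suc N) = deg N + int (d (Suc N)) * int (a (Suc N))"
  by (simp add: deg_def)

text \<open>Dissociation in the form used below: translates of \<open>{- deg N..deg N}\<close> by
  distinct multiples of \<open>a (Suc N)\<close> are disjoint.\<close>

lemma deg_less: "2 * deg N < int (a (Suc N))"
  using dissociate[of N] a_pos[of 1] by (cases "N = 0") (auto simp: deg_def)

lemma riesz_density_continuous_on: "continuous_on (sphere 0 1) (riesz_density N)"
  unfolding riesz_density_def trig_poly_def by (intro continuous_intros) auto

lemma riesz_density_nonneg:
  assumes "z \<in> sphere 0 1"
  shows "riesz_density N z \<in> \<real>\<^sub>\<ge>\<^sub>0"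
proof -
  have "trig_poly (d k) (c k) (z ^ a k) \<in> \<real>\<^sub>\<ge>\<^sub>0" if "k \<ge> 1" for k
    using assms that by (intro nonneg) (auto simp: norm_power)
  moreover have "prod f A \<in> \<real>\<^sub>\<ge>\<^sub>0" if "\<And>k. k \<in> A \<Longrightarrow> f k \<in> \<real>\<^sub>\<ge>\<^sub>0" for f :: "nat \<Rightarrow> complex" and A
    using that by (induction A rule: infinite_finite_induct) auto
  ultimately show ?thesis
    unfolding riesz_density_def by (meson atLeastAtMost_iff)
qed

lemma integrable_coeff: "integrable circle_lebesgue (\<lambda>z. z powi n * riesz_density N z)"
  by (intro circle_prob_integrable circle_prob_lebesgue continuous_on_mult
      continuous_on_circle_power_int riesz_density_continuous_on)

lemma coeff_0: "coeff 0 n = (if n = 0 then 1 else 0)"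
  by (simp add: coeff_def riesz_density_def circle_lebesgue_power_int)

lemma coeff_Suc:
  "coeff (Suc N) n =
    (\<Sum>m\<in>{- int (d (Suc N))..int (d (Suc N))}. c (Suc N) m * coeff N (n + m * int (a (Suc N))))"
proof -
  let ?M = "{- int (d (Suc N))..int (d (Suc N))}"
  have "coeff (Suc N) n = (LINT z|circle_lebesgue.
      (\<Sum>m\<in>?M. c (Suc N) m * (z powi (n + m * int (a (Suc N))) * riesz_density N z)))"
    unfolding coeff_def
  proof (rule Bochner_Integration.integral_cong)
    fix z
    assume "z \<in> space circle_lebesgue"
    then have "z \<noteq> 0"
      using circle_prob_space[OF circle_prob_lebesgue] by auto
    then have "z powi n * (z ^ a (Suc N)) powi m = z powi (n + m * int (a (Suc N)))" for m
      by (simp add: power_int_add mult.commute[of m] power_int_mult)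
    then have "z powi n * (riesz_density N z * (c (Suc N) m * (z ^ a (Suc N)) powi m))
        = c (Suc N) m * (z powi (n + m * int (a (Suc N))) * riesz_density N z)" for m
      by (metis mult.assoc mult.commute)
    moreover have "riesz_density (Suc N) z
        = riesz_density N z * (\<Sum>m\<in>?M. c (Suc N) m * (z ^ a (Suc N)) powi m)"
      by (simp add: riesz_density_def trig_poly_def)
    ultimately show "z powi n * riesz_density (Suc N) z
        = (\<Sum>m\<in>?M. c (Suc N) m * (z powi (n + m * int (a (Suc N))) * riesz_density N z))"
      by (simp only: sum_distrib_left)
  qed simp
  also have "\<dots> = (\<Sum>m\<in>?M. LINT z|circle_lebesgue.
      c (Suc N) m * (z powi (n + m * int (a (Suc N))) * riesz_density N z))"
    by (intro Bochner_Integration.integral_sum integrable_mult_right integrable_coeff)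
  finally show ?thesis
    by (simp add: coeff_def)
qed

lemma coeff_eq_0:
  assumes "\<bar>n\<bar> > deg N"
  shows "coeff N n = 0"
  using assms
proof (induction N arbitrary: n)
  case 0
  then show ?case by (simp add: coeff_0 deg_0)
next
  case (Suc N)
  have "coeff N (n + m * int (a (Suc N))) = 0"
    if "m \<in> {- int (d (Suc N))..int (d (Suc N))}" for m
  proof (rule Suc.IH)
    have "\<bar>m * int (a (Suc N))\<bar> \<le> int (d (Suc N)) * int (a (Suc N))"
      using that by (auto simp: abs_mult intro!: mult_right_mono)
    then show "deg N < \<bar>n + m * int (a (Suc N))\<bar>"
      using Suc.prems by (simp add: deg_Suc)
  qed
  then show ?case
    by (simp add: coeff_Suc)
qed

lemma abs_add_mult_ge:
  assumes "m \<noteq> 0"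
  shows "\<bar>n + m * int (a (Suc N))\<bar> \<ge> int (a (Suc N)) - \<bar>n\<bar>"
proof -
  have "1 * int (a (Suc N)) \<le> \<bar>m\<bar> * int (a (Suc N))"
    using assms by (intro mult_right_mono) auto
  then have "\<bar>m * int (a (Suc N))\<bar> \<ge> int (a (Suc N))"
    by (simp add: abs_mult)
  then show ?thesis by linarith
qed

lemma coeff_Suc_eq:
  assumes "\<bar>n\<bar> + deg N < int (a (Suc N))" and "\<bar>m\<bar> \<le> int (d (Suc N))"
  shows "coeff (Suc N) (n + m * int (a (Suc N))) = c (Suc N) (- m) * coeff N n"
proof -
  \<comment> \<open>only \<open>l = - m\<close> survives: any other \<open>l\<close> moves the argument beyond \<^term>\<open>deg N\<close>\<close>
  have "coeff (Suc N) (n + m * int (a (Suc N))) =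
      (\<Sum>l\<in>{- int (d (Suc N))..int (d (Suc N))}. c (Suc N) l * coeff N (n + (l + m) * int (a (Suc N))))"
    by (simp add: coeff_Suc algebra_simps)
  also have "\<dots> = (\<Sum>l\<in>{- m}. c (Suc N) l * coeff N (n + (l + m) * int (a (Suc N))))"
  proof (rule sum.mono_neutral_right)
    show "\<forall>l\<in>{- int (d (Suc N))..int (d (Suc N))} - {- m}.
        c (Suc N) l * coeff N (n + (l + m) * int (a (Suc N))) = 0"
    proof
      fix l
      assume "l \<in> {- int (d (Suc N))..int (d (Suc N))} - {- m}"
      then have "l + m \<noteq> 0" by auto
      then have "deg N < \<bar>n + (l + m) * int (a (Suc N))\<bar>"
        using abs_add_mult_ge[of "l + m" N n] assms(1) by linarith
      then show "c (Suc N) l * coeff N (n + (l + m) * int (a (Suc N))) = 0"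
        by (simp add: coeff_eq_0)
    qed
  qed (use assms(2) in auto)
  finally show ?thesis by simp
qed

text \<open>For \<open>N \<ge> K\<close>, \<open>\<bar>n\<bar>\<close> is at most half of
  \<open>a (Suc N)\<close> and \<open>deg N\<close> is strictly less than half, so
  \<open>coeff_Suc_eq\<close> applies with \<open>m = 0\<close>; the constant coefficient
  \<open>1\<close> leaves the value unchanged.\<close>

lemma coeff_stable:
  assumes "2 * \<bar>n\<bar> \<le> int (a (Suc K))" and "N \<ge> K"
  shows "coeff N n = coeff K n"
  using assms(2)
proof (induction N rule: dec_induct)
  case (step N)
  have "a (Suc K) \<le> a (Suc N)"
    using strict_mono_onD[OF mono, of "Suc K" "Suc N"] step.hyps(1)
    by (cases "K = N") auto
  then have "\<bar>n\<bar> + deg N < int (a (Suc N))"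
    using assms(1) deg_less[of N] by linarith
  then show ?case
    using coeff_Suc_eq[of n N 0] step.IH by (simp add: c_0)
qed simp

text \<open>The lower digits sum to at most \<open>deg N\<close> in absolute value, so dissociation
  lets the top digit be split off as a factor.\<close>

lemma coeff_sum:
  assumes "\<And>j. j \<in> {1..N} \<Longrightarrow> \<bar>m j\<bar> \<le> int (d j)"
  shows "coeff N (\<Sum>j=1..N. m j * int (a j)) = (\<Prod>j=1..N. c j (- m j))"
  using assms
proof (induction N)
  case 0
  then show ?case by (simp add: coeff_0)
next
  case (Suc N)
  have "\<bar>\<Sum>j=1..N. m j * int (a j)\<bar> \<le> (\<Sum>j=1..N. \<bar>m j * int (a j)\<bar>)"
    by (rule sum_abs)
  also have "\<dots> \<le> deg N"
    unfolding deg_def using Suc.prems by (intro sum_mono) (auto simp: abs_mult intro!: mult_right_mono)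
  finally have "\<bar>\<Sum>j=1..N. m j * int (a j)\<bar> + deg N < int (a (Suc N))"
    using deg_less[of N] by linarith
  from coeff_Suc_eq[OF this Suc.prems[of "Suc N"]] show ?case
    using Suc.IH Suc.prems by simp
qed

text \<open>By \<open>coeff_Suc\<close>, each new support is covered by
  \<open>2 * d (Suc N) + 1\<close> translates of the previous one.\<close>

lemma coeff_support:
  "finite {n. coeff N n \<noteq> 0} \<and> card {n. coeff N n \<noteq> 0} \<le> (\<Prod>j=1..N. 2 * d j + 1)"
proof (induction N)
  case 0
  then show ?case by (simp add: coeff_0)
next
  case (Suc N)
  let ?M = "{- int (d (Suc N))..int (d (Suc N))}"
  let ?f = "\<lambda>(m, l). l - m * int (a (Suc N))"
  let ?A = "?M \<times> {n. coeff N n \<noteq> 0}"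
  have sub: "{n. coeff (Suc N) n \<noteq> 0} \<subseteq> ?f ` ?A"
  proof
    fix n
    assume "n \<in> {n. coeff (Suc N) n \<noteq> 0}"
    then obtain m where "m \<in> ?M" "coeff N (n + m * int (a (Suc N))) \<noteq> 0"
      using sum.not_neutral_contains_not_neutral[of _ ?M] by (force simp: coeff_Suc)
    then show "n \<in> ?f ` ?A"
      by (intro image_eqI[of _ _ "(m, n + m * int (a (Suc N)))"]) auto
  qed
  have fin: "finite ?A"
    using Suc.IH by simp
  have "card {n. coeff (Suc N) n \<noteq> 0} \<le> card (?f ` ?A)"
    using sub fin by (intro card_mono) auto
  also have "\<dots> \<le> card ?A"
    using fin by (rule card_image_le)
  also have "\<dots> = (2 * d (Suc N) + 1) * card {n. coeff N n \<noteq> 0}"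
    by (simp add: card_cartesian_product nat_add_distrib nat_mult_distrib)
  also have "\<dots> \<le> (2 * d (Suc N) + 1) * (\<Prod>j=1..N. 2 * d j + 1)"
    using Suc.IH by (intro mult_left_mono) auto
  also have "\<dots> = (\<Prod>j=1..Suc N. 2 * d j + 1)"
    by simp
  finally show ?case
    using finite_subset[OF sub] fin by blast
qed

lemma coeff_at_0: "coeff N 0 = 1"
  using coeff_stable[of 0 0 N] by (simp add: coeff_0)

section \<open>The partial products as probability measures, and their limit\<close>

lemma Re_riesz_density:
  assumes "z \<in> sphere 0 1"
  shows "Re (riesz_density N z) \<ge> 0" and "complex_of_real (Re (riesz_density N z)) = riesz_density N z"
  using riesz_density_nonneg[OF assms] by (auto simp: complex_nonneg_Reals_iff complex_eq_iff)

lemma Re_riesz_density_measurable: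
  "(\<lambda>z. Re (riesz_density N z)) \<in> borel_measurable circle_lebesgue"
  by (rule circle_prob_measurable[OF circle_prob_lebesgue
        continuous_on_Re[OF riesz_density_continuous_on]])

lemma riesz_partial_eq:
  "riesz_partial d c a N = density circle_lebesgue (\<lambda>z. ennreal (Re (riesz_density N z)))"
  by (simp add: riesz_partial_def riesz_density_def)

lemma AE_Re_riesz_density: "AE z in circle_lebesgue. 0 \<le> Re (riesz_density N z)"
  by (rule AE_I2) (use Re_riesz_density(1) circle_prob_space[OF circle_prob_lebesgue] in auto)

lemma fourier_coeff_riesz_partial: "fourier_coeff (riesz_partial d c a N) n = coeff N n"
proof -
  have "fourier_coeff (riesz_partial d c a N) n
      = (LINT z|circle_lebesgue. Re (riesz_density N z) *\<^sub>R (z powi n))"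
    unfolding fourier_coeff_def riesz_partial_eq
    by (rule integral_density[OF circle_prob_measurable[OF circle_prob_lebesgue
            continuous_on_circle_power_int] Re_riesz_density_measurable AE_Re_riesz_density])
  also have "\<dots> = coeff N n"
    unfolding coeff_def
    by (intro Bochner_Integration.integral_cong)
      (use Re_riesz_density(2) circle_prob_space[OF circle_prob_lebesgue] in
        \<open>auto simp: scaleR_conv_of_real mult.commute\<close>)
  finally show ?thesis .
qed

lemma circle_prob_riesz_partial: "circle_prob (riesz_partial d c a N)"
proof -
  have "integrable circle_lebesgue (riesz_density N)"
    by (rule circle_prob_integrable[OF circle_prob_lebesgue riesz_density_continuous_on])
  then have int: "integrable circle_lebesgue (\<lambda>z. Re (riesz_density N z))"
    by simp
  have "emeasure (riesz_partial d c a N) (space (riesz_partial d c a N))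
      = (\<integral>\<^sup>+ z. ennreal (Re (riesz_density N z)) \<partial>circle_lebesgue)"
    unfolding riesz_partial_eq using Re_riesz_density_measurable
    by (simp add: emeasure_density cong: nn_integral_cong)
  also have "\<dots> = ennreal (LINT z|circle_lebesgue. Re (riesz_density N z))"
    using int AE_Re_riesz_density by (rule nn_integral_eq_integral)
  also have "(LINT z|circle_lebesgue. Re (riesz_density N z)) = Re (coeff N 0)"
    using \<open>integrable circle_lebesgue (riesz_density N)\<close> by (simp add: coeff_def)
  finally have "prob_space (riesz_partial d c a N)"
    by (intro prob_spaceI) (simp add: coeff_at_0)
  then show ?thesis
    using circle_prob_lebesgue by (simp add: circle_prob_def riesz_partial_eq)
qed

lemma le_a_Suc: "N \<le> a (Suc N)"
proof (induction N)
  case (Suc N)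
  then show ?case
    using strict_mono_onD[OF mono, of "Suc N" "Suc (Suc N)"] by auto
qed simp

theorem riesz_product_exists:
  obtains \<sigma> where "circle_prob \<sigma>" "circle_weak_star_limit (riesz_partial d c a) \<sigma>"
    "\<And>K n. 2 * \<bar>n\<bar> \<le> int (a (Suc K)) \<Longrightarrow> fourier_coeff \<sigma> n = coeff K n"
proof -
  have lim: "(\<lambda>N. fourier_coeff (riesz_partial d c a N) n) \<longlonglongrightarrow> coeff K n"
    if "2 * \<bar>n\<bar> \<le> int (a (Suc K))" for K n
  proof (rule tendsto_eventually)
    show "\<forall>\<^sub>F N in sequentially. fourier_coeff (riesz_partial d c a N) n = coeff K n"
      using eventually_ge_at_top[of K]
      by eventually_elim (simp only: fourier_coeff_riesz_partial, rule coeff_stable[OF that])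
  qed
  \<comment> \<open>Since \<open>K \<le> a (Suc K)\<close>, taking
    \<open>K = 2 * \<bar>n\<bar>\<close> puts \<open>n\<close> in the range where the coefficient
    has stabilised.\<close>
  have "convergent (\<lambda>N. fourier_coeff (riesz_partial d c a N) n)" for n
    using lim[of n "nat (2 * \<bar>n\<bar>)"] le_a_Suc[of "nat (2 * \<bar>n\<bar>)"] convergentI by fastforce
  then obtain \<sigma> where \<sigma>: "circle_prob \<sigma>" "circle_weak_star_limit (riesz_partial d c a) \<sigma>"
    using circle_weak_star_limit_exists circle_prob_riesz_partial by blast
  have "fourier_coeff \<sigma> n = coeff K n" if "2 * \<bar>n\<bar> \<le> int (a (Suc K))" for K n
  proof (rule LIMSEQ_unique)
    show "(\<lambda>N. fourier_coeff (riesz_partial d c a N) n) \<longlonglongrightarrow> fourier_coeff \<sigma> n"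
      using \<sigma>(2) continuous_on_circle_power_int
      unfolding circle_weak_star_limit_def fourier_coeff_def by blast
  qed (rule lim[OF that])
  with \<sigma> show ?thesis
    using that by blast
qed

end

section \<open>Absence of atoms\<close>

lemma circle_point_mass_tendsto:
  assumes "circle_prob \<sigma>" and w: "w \<in> sphere 0 1"
  shows "(\<lambda>N. (\<Sum>n<N. fourier_coeff \<sigma> (int n) / w ^ n) / of_nat N)
    \<longlonglongrightarrow> complex_of_real (measure \<sigma> {w})"
proof -
  interpret prob_space \<sigma>
    using assms(1) by (simp add: circle_prob_def)
  \<comment> \<open>the Cesaro means of \<open>(z / w)\<^sup>n\<close> converge boundedly to the indicator of \<open>{w}\<close>\<close>
  define g where "g N z = (\<Sum>n<N. z powi int n / w ^ n) / of_nat N" for N and z :: complex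
  have g_cont: "continuous_on (sphere 0 1) (g N)" for N
    unfolding g_def divide_inverse
    by (intro continuous_intros continuous_on_circle_power_int[unfolded power_int_of_nat]) auto
  have g_eq: "g N z = (\<Sum>n<N. (z / w) ^ n) / of_nat N" for N z
    by (simp add: g_def power_divide)
  have "(\<Sum>n<N. fourier_coeff \<sigma> (int n) / w ^ n) / of_nat N = (LINT z|\<sigma>. g N z)" for N
  proof -
    have "integrable \<sigma> (\<lambda>z. z powi int n / w ^ n)" for n
      by (intro integrable_divide circle_prob_integrable assms(1) continuous_on_circle_power_int)
    then have "(LINT z|\<sigma>. (\<Sum>n<N. z powi int n / w ^ n))
        = (\<Sum>n<N. (LINT z|\<sigma>. z powi int n / w ^ n))"
      by (intro Bochner_Integration.integral_sum)
    then show ?thesis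
      unfolding fourier_coeff_def g_def by (simp del: power_int_of_nat)
  qed
  moreover have "(\<lambda>N. LINT z|\<sigma>. g N z) \<longlonglongrightarrow> (LINT z|\<sigma>. indicator {w} z)"
  proof (rule integral_dominated_convergence[where w = "\<lambda>_. 1"])
    show "g N \<in> borel_measurable \<sigma>" for N
      by (rule circle_prob_measurable[OF assms(1) g_cont])
    have "{w} \<in> sets \<sigma>"
      using assms by (auto simp: circle_prob_def circle_borel_def sets_restrict_space)
    then show "indicator {w} \<in> borel_measurable \<sigma>"
      by simp
    show "AE z in \<sigma>. norm (g N z) \<le> 1" for N
    proof (rule AE_I2)
      fix z
      assume "z \<in> space \<sigma>"
      then have "cmod (z / w) = 1"
        using w circle_prob_space[OF assms(1)] by (simp add: norm_divide)
      then have "norm (\<Sum>n<N. (z / w) ^ n) \<le> real N"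
        using sum_norm_bound[of "{..<N}" "\<lambda>n. (z / w) ^ n" 1] by (simp add: norm_power)
      then show "norm (g N z) \<le> 1"
        by (cases "N = 0") (auto simp: g_eq norm_divide)
    qed
    show "AE z in \<sigma>. (\<lambda>N. g N z) \<longlonglongrightarrow> indicator {w} z"
    proof (rule AE_I2)
      fix z
      assume "z \<in> space \<sigma>"
      then have z: "cmod (z / w) = 1"
        using w circle_prob_space[OF assms(1)] by (simp add: norm_divide)
      show "(\<lambda>N. g N z) \<longlonglongrightarrow> indicator {w} z"
      proof (cases "z = w")
        case True
        have "\<forall>\<^sub>F N in sequentially. g N z = 1"
          using eventually_gt_at_top[of 0] by eventually_elim (use True w in \<open>auto simp: g_eq\<close>)
        then show ?thesis
          using True by (simp add: tendsto_eventually)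
      next
        case False
        define u where "u = z / w"
        have "u \<noteq> 1"
          using False w by (auto simp: u_def)
        \<comment> \<open>For \<open>u\<close> different from \<open>1\<close> the geometric sums
          stay bounded, so their means decay like \<open>1 / N\<close>.\<close>
        have "norm (g N z) \<le> 2 / cmod (u - 1) * (1 / real N)" for N
        proof -
          have "norm (\<Sum>n<N. u ^ n) = cmod (u ^ N - 1) / cmod (u - 1)"
            using \<open>u \<noteq> 1\<close> by (simp add: geometric_sum norm_divide)
          also have "\<dots> \<le> 2 / cmod (u - 1)"
            using z norm_triangle_ineq4[of "u ^ N" 1]
            by (intro divide_right_mono) (auto simp: norm_power u_def)
          finally have "norm (\<Sum>n<N. u ^ n) / real N \<le> 2 / cmod (u - 1) / real N"
            by (rule divide_right_mono) simp
          then show ?thesis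
            unfolding g_eq u_def[symmetric] by (simp add: norm_divide)
        qed
        moreover have "(\<lambda>N. 2 / cmod (u - 1) * (1 / real N)) \<longlonglongrightarrow> 2 / cmod (u - 1) * 0"
          by (intro tendsto_intros lim_1_over_n)
        ultimately have "(\<lambda>N. g N z) \<longlonglongrightarrow> 0"
          by (intro Lim_null_comparison[of "\<lambda>N. g N z" "\<lambda>N. 2 / cmod (u - 1) * (1 / real N)"]) auto
        with False show ?thesis
          by simp
      qed
    qed
  qed simp
  moreover have "(LINT z|\<sigma>. indicator {w} z) = complex_of_real (measure \<sigma> {w})"
  proof -
    have "{w} \<inter> space \<sigma> = {w}"
      using w circle_prob_space[OF assms(1)] by auto
    moreover have "(LINT z|\<sigma>. indicator {w} z :: complex)
        = (LINT z|\<sigma>. complex_of_real (indicator {w} z))"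
      by (intro Bochner_Integration.integral_cong) (auto simp: indicator_def)
    ultimately show ?thesis
      by (simp add: integral_complex_of_real)
  qed
  ultimately show ?thesis
    by simp
qed

text \<open>The twisted means converge to the mass of \<open>{w}\<close>, so their limit may be
  computed along the subsequence \<open>N k\<close>. As \<open>cmod w = 1\<close>, the twist
  disappears in absolute value.\<close>

lemma continuous_measure_if_mean_tendsto_0:
  assumes "circle_prob \<sigma>" and N: "filterlim N at_top sequentially"
    and mean: "(\<lambda>k. (\<Sum>n<N k. cmod (fourier_coeff \<sigma> (int n))) / real (N k)) \<longlonglongrightarrow> 0"
  shows "continuous_measure \<sigma>"
  unfolding continuous_measure_def
proof
  fix w
  assume "w \<in> space \<sigma>"
  then have w: "w \<in> sphere 0 1"
    using circle_prob_space[OF assms(1)] by simp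
  interpret prob_space \<sigma>
    using assms(1) by (simp add: circle_prob_def)
  have "(\<lambda>k. (\<Sum>n<N k. fourier_coeff \<sigma> (int n) / w ^ n) / of_nat (N k))
      \<longlonglongrightarrow> complex_of_real (measure \<sigma> {w})"
    by (rule filterlim_compose[OF circle_point_mass_tendsto[OF assms(1) w] N])
  moreover have "(\<lambda>k. (\<Sum>n<N k. fourier_coeff \<sigma> (int n) / w ^ n) / of_nat (N k)) \<longlonglongrightarrow> 0"
  proof (rule Lim_null_comparison[OF _ mean], rule always_eventually, rule allI)
    fix k
    have "norm (\<Sum>n<N k. fourier_coeff \<sigma> (int n) / w ^ n) \<le> (\<Sum>n<N k. cmod (fourier_coeff \<sigma> (int n)))"
      using w by (intro sum_norm_le) (simp add: norm_divide norm_power)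
    then show "norm ((\<Sum>n<N k. fourier_coeff \<sigma> (int n) / w ^ n) / of_nat (N k))
        \<le> (\<Sum>n<N k. cmod (fourier_coeff \<sigma> (int n))) / real (N k)"
      by (simp add: norm_divide divide_right_mono)
  qed
  ultimately have "complex_of_real (measure \<sigma> {w}) = 0"
    by (rule LIMSEQ_unique)
  then show "emeasure \<sigma> {w} = 0"
    by (simp add: emeasure_eq_measure)
qed

context dissociated_riesz
begin

theorem continuous_measure_if_sparse:
  assumes "circle_prob \<sigma>"
    and coeffs: "\<And>K n. 2 * \<bar>n\<bar> \<le> int (a (Suc K)) \<Longrightarrow> fourier_coeff \<sigma> n = coeff K n"
    and sparse: "(\<lambda>k. real (\<Prod>j=1..k. 2 * d j + 1) / real (a (Suc k))) \<longlonglongrightarrow> 0"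
  shows "continuous_measure \<sigma>"
proof (rule continuous_measure_if_mean_tendsto_0[OF assms(1)])
  \<comment> \<open>every \<open>n < N k\<close> satisfies \<open>2 * n \<le> a (Suc k)\<close>, the range where \<open>coeffs\<close> applies\<close>
  define N where "N k = a (Suc k) div 2 + 1" for k
  show "filterlim N at_top sequentially"
  proof (rule filterlim_at_top_mono)
    show "filterlim (\<lambda>k::nat. k div 2) at_top sequentially"
      by (rule filterlim_at_top_div_const_nat) simp
    show "\<forall>\<^sub>F k in sequentially. k div 2 \<le> N k"
      using div_le_mono[OF le_a_Suc] by (auto simp: N_def intro!: always_eventually le_SucI)
  qed
  show "(\<lambda>k. (\<Sum>n<N k. cmod (fourier_coeff \<sigma> (int n))) / real (N k)) \<longlonglongrightarrow> 0"
  proof (rule Lim_null_comparison)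
    show "(\<lambda>k. 2 * (real (\<Prod>j=1..k. 2 * d j + 1) / real (a (Suc k)))) \<longlonglongrightarrow> 0"
      using tendsto_mult_right_zero[OF sparse] by simp
    show "\<forall>\<^sub>F k in sequentially. norm ((\<Sum>n<N k. cmod (fourier_coeff \<sigma> (int n))) / real (N k))
        \<le> 2 * (real (\<Prod>j=1..k. 2 * d j + 1) / real (a (Suc k)))"
    proof (rule always_eventually, rule allI)
      fix k
      have "(\<Sum>n<N k. cmod (fourier_coeff \<sigma> (int n))) = (\<Sum>n\<in>{n\<in>{..<N k}. coeff k (int n) \<noteq> 0}. cmod (fourier_coeff \<sigma> (int n)))"
        by (rule sum.mono_neutral_right) (auto simp: N_def coeffs[of _ k] not_less)
      also have "\<dots> \<le> real (card {n\<in>{..<N k}. coeff k (int n) \<noteq> 0}) * 1"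
      proof (rule sum_bounded_above)
        show "cmod (fourier_coeff \<sigma> (int n)) \<le> 1" for n
          unfolding fourier_coeff_def
          by (rule circle_prob_norm_integral_le[OF assms(1)]) (auto simp: norm_power)
      qed
      also have "card {n\<in>{..<N k}. coeff k (int n) \<noteq> 0} \<le> card {n. coeff k n \<noteq> 0}"
        using coeff_support by (intro card_inj_on_le[of int]) (auto simp: inj_on_def)
      also have "\<dots> \<le> (\<Prod>j=1..k. 2 * d j + 1)"
        using coeff_support by blast
      finally have "(\<Sum>n<N k. cmod (fourier_coeff \<sigma> (int n))) \<le> real (\<Prod>j=1..k. 2 * d j + 1)"
        by simp
      moreover have "real (a (Suc k)) / 2 \<le> real (N k)" "real (a (Suc k)) > 0"
        using a_pos[of "Suc k"] by (auto simp: N_def)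
      ultimately have "(\<Sum>n<N k. cmod (fourier_coeff \<sigma> (int n))) / real (N k)
          \<le> real (\<Prod>j=1..k. 2 * d j + 1) / (real (a (Suc k)) / 2)"
        by (intro frac_le) (auto intro: prod_nonneg)
      then show "norm ((\<Sum>n<N k. cmod (fourier_coeff \<sigma> (int n))) / real (N k))
        \<le> 2 * (real (\<Prod>j=1..k. 2 * d j + 1) / real (a (Suc k)))"
        by (simp add: sum_nonneg mult_ac)
    qed
  qed
qed

end

section \<open>Jackson kernels\<close>

text \<open>The coefficients of \<open>h\<close> times the Fejer kernel of degree
  \<open>h - 1\<close>; the normalised square of that kernel is the Jackson kernel.\<close>

definition tent :: "nat \<Rightarrow> int \<Rightarrow> real" where
  "tent h j = max 0 (of_int (int h - \<bar>j\<bar>))"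

text \<open>Fourier coefficients of \<open>\<bar>Q\<bar>\<^sup>2\<close> divided by its mean, where \<open>Q\<close> has the coefficients
  \<^term>\<open>tent h\<close>.\<close>
definition jackson_coeff :: "nat \<Rightarrow> int \<Rightarrow> real" where
  "jackson_coeff h m = (\<Sum>j\<in>{- int h..int h}. tent h j * tent h (j + m))
      / (\<Sum>j\<in>{- int h..int h}. (tent h j)\<^sup>2)"

lemma tent_nonneg: "tent h j \<ge> 0"
  by (simp add: tent_def)

lemma tent_eq_0: "\<bar>j\<bar> \<ge> int h \<Longrightarrow> tent h j = 0"
  by (simp add: tent_def)

lemma tent_lipschitz: "\<bar>tent h (j + m) - tent h j\<bar> \<le> \<bar>of_int m\<bar>"
  unfolding tent_def by linarith

lemma sum_shift_int:
  fixes f :: "int \<Rightarrow> 'a::comm_monoid_add"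
  assumes "\<And>j. j \<notin> A \<Longrightarrow> f j = 0" and "finite A" and "finite J" and "(\<lambda>j. j - m) ` A \<subseteq> J"
  shows "(\<Sum>j\<in>J. f (j + m)) = (\<Sum>j\<in>A. f j)"
proof -
  have "(\<Sum>j\<in>J. f (j + m)) = (\<Sum>j\<in>(\<lambda>j. j - m) ` A. f (j + m))"
    using assms by (intro sum.mono_neutral_right) force+
  also have "\<dots> = (\<Sum>j\<in>A. f j)"
    by (subst sum.reindex) (auto simp: inj_on_def)
  finally show ?thesis .
qed

text \<open>The right half of the tent alone contributes the squares of
  \<open>0, ..., h\<close>.\<close>

lemma sum_tent_sq_ge: "(\<Sum>j\<in>{- int h..int h}. (tent h j)\<^sup>2) \<ge> real h ^ 3 / 3"
proof -
  have "real h ^ 3 / 3 \<le> (\<Sum>i\<le>h. (real i)\<^sup>2)"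
    by (induction h) (auto simp: power2_eq_square power3_eq_cube algebra_simps)
  also have "\<dots> = (\<Sum>j\<in>(\<lambda>i. int h - int i) ` {..h}. (tent h j)\<^sup>2)"
    by (subst sum.reindex) (auto simp: inj_on_def tent_def intro!: sum.cong)
  also have "\<dots> \<le> (\<Sum>j\<in>{- int h..int h}. (tent h j)\<^sup>2)"
    by (intro sum_mono2) auto
  finally show ?thesis .
qed

lemma sum_tent_sq_pos:
  assumes "h > 0"
  shows "(\<Sum>j\<in>{- int h..int h}. (tent h j)\<^sup>2) > 0"
  using assms by (intro less_le_trans[OF _ sum_tent_sq_ge]) auto

lemma jackson_coeff_0:
  assumes "h > 0"
  shows "jackson_coeff h 0 = 1"
  using sum_tent_sq_pos[OF assms] by (simp add: jackson_coeff_def power2_eq_square)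

lemma jackson_coeff_nonneg: "jackson_coeff h m \<ge> 0"
  by (auto simp: jackson_coeff_def tent_nonneg intro!: divide_nonneg_nonneg sum_nonneg)

lemma jackson_coeff_minus: "jackson_coeff h (- m) = jackson_coeff h m"
proof -
  have minus: "tent h (- j) = tent h j" for j
    by (simp add: tent_def)
  have "(\<Sum>j\<in>{- int h..int h}. tent h j * tent h (j + - m))
      = (\<Sum>j\<in>{- int h..int h}. tent h j * tent h (j + m))"
    by (rule sum.reindex_bij_witness[of _ uminus uminus])
      (auto simp: minus minus[of "_ - _", simplified])
  then show ?thesis
    by (simp add: jackson_coeff_def)
qed

text \<open>Expand the square: the tent and its shift have the same sum of squares. The range is
  widened by \<open>\<bar>m\<bar>\<close> to contain both supports.\<close>

lemma jackson_coeff_defect: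
  assumes "h > 0"
  shows "2 * (\<Sum>j\<in>{- int h..int h}. (tent h j)\<^sup>2) * (1 - jackson_coeff h m)
    = (\<Sum>j\<in>{- (int h + \<bar>m\<bar>)..int h + \<bar>m\<bar>}. (tent h (j + m) - tent h j)\<^sup>2)"
proof -
  let ?A = "{- int h..int h}" and ?J = "{- (int h + \<bar>m\<bar>)..int h + \<bar>m\<bar>}"
  have eq0: "tent h j = 0" if "j \<notin> ?A" for j
    using that by (intro tent_eq_0) auto
  have "(\<Sum>j\<in>?J. (tent h (j + m))\<^sup>2) = (\<Sum>j\<in>?A. (tent h j)\<^sup>2)"
    by (rule sum_shift_int) (auto simp: eq0)
  moreover have "(\<Sum>j\<in>?J. (tent h j)\<^sup>2) = (\<Sum>j\<in>?A. (tent h j)\<^sup>2)"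
    by (rule sum.mono_neutral_right) (auto simp: eq0)
  moreover have "(\<Sum>j\<in>?J. tent h j * tent h (j + m)) = (\<Sum>j\<in>?A. tent h j * tent h (j + m))"
    by (rule sum.mono_neutral_right) (auto simp: eq0)
  moreover have "(\<Sum>j\<in>?J. (tent h (j + m) - tent h j)\<^sup>2)
      = (\<Sum>j\<in>?J. (tent h (j + m))\<^sup>2) + (\<Sum>j\<in>?J. (tent h j)\<^sup>2)
        - 2 * (\<Sum>j\<in>?J. tent h j * tent h (j + m))"
    by (simp add: power2_diff sum.distrib sum_subtractf sum_distrib_left mult_ac)
  moreover have "2 * (\<Sum>j\<in>?A. (tent h j)\<^sup>2) * (1 - jackson_coeff h m)
      = 2 * (\<Sum>j\<in>?A. (tent h j)\<^sup>2) - 2 * (\<Sum>j\<in>?A. tent h j * tent h (j + m))"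
    using sum_tent_sq_pos[OF assms] by (simp add: jackson_coeff_def right_diff_distrib)
  ultimately show ?thesis
    by linarith
qed

lemma jackson_coeff_le_1:
  assumes "h > 0"
  shows "jackson_coeff h m \<le> 1"
proof -
  have "0 \<le> 2 * (\<Sum>j\<in>{- int h..int h}. (tent h j)\<^sup>2) * (1 - jackson_coeff h m)"
    unfolding jackson_coeff_defect[OF assms] by (intro sum_nonneg) auto
  then show ?thesis
    using sum_tent_sq_pos[OF assms] by (simp add: zero_le_mult_iff)
qed

text \<open>If \<open>\<bar>m\<bar> \<le> h\<close>, the defect is a sum of at most
  \<open>5 * h\<close> terms, each at most the square of \<open>m\<close> because the tent is
  1-Lipschitz. Division by twice the lower bound \<open>h ^ 3 / 3\<close> gives the constant
  \<open>15 / 2\<close>, rounded up to \<open>8\<close>. Otherwise the right side exceeds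
  \<open>1\<close>.\<close>

lemma jackson_coeff_ge:
  assumes "h > 0"
  shows "1 - jackson_coeff h m \<le> 8 * (of_int m / real h)\<^sup>2"
proof (cases "\<bar>m\<bar> \<le> int h")
  case True
  let ?B = "\<Sum>j\<in>{- int h..int h}. (tent h j)\<^sup>2"
  have "2 * ?B * (1 - jackson_coeff h m)
      \<le> (\<Sum>j\<in>{- (int h + \<bar>m\<bar>)..int h + \<bar>m\<bar>}. (of_int m)\<^sup>2)"
    unfolding jackson_coeff_defect[OF assms]
    using tent_lipschitz by (intro sum_mono) (simp flip: abs_le_square_iff)
  also have "\<dots> = of_int (2 * int h + 2 * \<bar>m\<bar> + 1) * (of_int m)\<^sup>2"
    by (simp add: of_nat_nat)
  also have "\<dots> \<le> 5 * real h * (of_int m)\<^sup>2"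
    using True assms by (intro mult_right_mono) (linarith, simp)
  finally have *: "2 * ?B * (1 - jackson_coeff h m) \<le> 5 * real h * (of_int m)\<^sup>2" .
  have "2 * (real h ^ 3 / 3) * (1 - jackson_coeff h m) \<le> 2 * ?B * (1 - jackson_coeff h m)"
    using sum_tent_sq_ge[of h] jackson_coeff_le_1[OF assms] by (intro mult_right_mono) auto
  from order_trans[OF this *] have "real h * (2 * (real h)\<^sup>2 * (1 - jackson_coeff h m)) \<le> real h * (15 * (of_int m)\<^sup>2)"
    by (simp add: power3_eq_cube power2_eq_square)
  then have "2 * (real h)\<^sup>2 * (1 - jackson_coeff h m) \<le> 15 * (of_int m)\<^sup>2"
    using assms by simp
  then have "2 * (real h)\<^sup>2 * (1 - jackson_coeff h m) \<le> 16 * (of_int m)\<^sup>2"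
    using zero_le_power2[of "real_of_int m"] by linarith
  then show ?thesis
    using assms by (simp add: power_divide field_simps)
next
  case False
  then have "1 \<le> \<bar>of_int m / real h\<bar>"
    using assms by (simp add: field_simps)
  then have "1 \<le> (of_int m / real h)\<^sup>2"
    using abs_le_square_iff[of 1 "of_int m / real h"] by simp
  then show ?thesis
    using jackson_coeff_nonneg[of h m] by linarith
qed

text \<open>The polynomial is the squared modulus of \<open>Q\<close> divided by a positive number.
  The tent vanishes at \<open>h\<close> and \<open>- h\<close>, so \<open>Q\<close> has degree
  \<open>h - 1\<close> and its square fits into degree \<open>d\<close>.\<close>

lemma trig_poly_jackson_nonneg:
  assumes "h > 0" and "2 * (h - 1) \<le> d" and "z \<in> sphere 0 1"
  shows "trig_poly d (\<lambda>m. complex_of_real (jackson_coeff h m)) z \<in> \<real>\<^sub>\<ge>\<^sub>0"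
proof -
  let ?A = "{- int h..int h}" and ?D = "{- int d..int d}"
  let ?B = "\<Sum>j\<in>?A. (tent h j)\<^sup>2"
  define Q where "Q = (\<Sum>j\<in>?A. complex_of_real (tent h j) * z powi j)"
  have "z \<noteq> 0" and "cmod z = 1"
    using assms(3) by auto
  have cnj_power: "cnj (z powi j) = z powi (- j)" for j
  proof -
    have "cmod (z powi j) = 1"
      using \<open>cmod z = 1\<close> by (simp add: norm_power_int)
    then have "z powi j * cnj (z powi j) = 1"
      using complex_norm_square[of "z powi j"] by simp
    then show ?thesis
      by (simp add: power_int_minus inverse_unique)
  qed
  have inner: "(\<Sum>m\<in>?D. complex_of_real (tent h j) * complex_of_real (tent h (j + m)) * z powi m)
      = complex_of_real (tent h j) * cnj (z powi j) * Q" for j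
  proof (cases "\<bar>j\<bar> < int h")
    case True
    define f where "f l = complex_of_real (tent h l) * z powi (l - j)" for l
    \<comment> \<open>With \<open>j\<close> and \<open>l\<close> both in this smaller range,
      \<open>l - j\<close> is at most \<open>2 * (h - 1)\<close> in absolute value, so no frequency
      is cut off by \<open>d\<close>.\<close>
    let ?A' = "{- (int h - 1)..int h - 1}"
    have eq0: "f l = 0" if "l \<notin> ?A'" for l
      using that by (auto simp: f_def intro!: tent_eq_0)
    have "(\<Sum>m\<in>?D. complex_of_real (tent h j) * complex_of_real (tent h (j + m)) * z powi m)
        = complex_of_real (tent h j) * (\<Sum>m\<in>?D. f (m + j))"
      by (simp add: f_def sum_distrib_left mult_ac add.commute)
    also have "(\<Sum>m\<in>?D. f (m + j)) = (\<Sum>l\<in>?A'. f l)"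
      using assms(1,2) True eq0 by (intro sum_shift_int) auto
    also have "\<dots> = (\<Sum>l\<in>?A. f l)"
      using eq0 by (intro sum.mono_neutral_left) auto
    also have "\<dots> = cnj (z powi j) * Q"
      using \<open>z \<noteq> 0\<close>
      by (simp del: complex_cnj_power_int add: f_def Q_def cnj_power sum_distrib_left power_int_diff power_int_minus divide_inverse mult_ac)
    finally show ?thesis
      by (simp add: mult_ac)
  qed (simp add: tent_eq_0)
  have "trig_poly d (\<lambda>m. complex_of_real (jackson_coeff h m)) z
      = (\<Sum>m\<in>?D. \<Sum>j\<in>?A. complex_of_real (tent h j) * complex_of_real (tent h (j + m)) * z powi m)
        / complex_of_real ?B"
    by (simp add: trig_poly_def jackson_coeff_def sum_divide_distrib sum_distrib_right)
  also have "(\<Sum>m\<in>?D. \<Sum>j\<in>?A. complex_of_real (tent h j) * complex_of_real (tent h (j + m)) * z powi m)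
      = (\<Sum>j\<in>?A. complex_of_real (tent h j) * cnj (z powi j) * Q)"
    by (subst sum.swap) (simp add: inner)
  also have "\<dots> = cnj Q * Q"
    by (simp add: Q_def sum_distrib_right)
  also have "\<dots> / complex_of_real ?B = complex_of_real ((cmod Q)\<^sup>2 / ?B)"
    by (simp only: of_real_divide complex_norm_square mult.commute)
  finally show ?thesis
    using sum_tent_sq_pos[OF assms(1)] by (simp only: nonneg_Reals_of_real_iff) simp
qed

section \<open>Blocks of divisibility\<close>

text \<open>Proper divisibility at least doubles each term, so the sum is dominated by a geometric
  one.\<close>

lemma sum_dvd_chain_le:
  fixes n :: "nat \<Rightarrow> nat"
  assumes "p \<le> q" and "\<And>k. p \<le> k \<Longrightarrow> k < q \<Longrightarrow> n k dvd n (Suc k) \<and> n k < n (Suc k)"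
  shows "(\<Sum>k=p..q. n k) \<le> 2 * n q"
  using assms
proof (induction q rule: dec_induct)
  case (step q)
  have "n q dvd n (Suc q)" "n q < n (Suc q)"
    using step.prems[of q] step.hyps by auto
  then obtain r where r: "n (Suc q) = n q * r" "n q * 1 < n q * r"
    by (auto elim: dvdE)
  then have "r \<ge> 2"
    by (cases "r \<le> 1") (auto dest: mult_le_mono2[of r 1 "n q"])
  then have "2 * n q \<le> n (Suc q)"
    unfolding r(1) by (metis mult.commute mult_le_mono2)
  with step show ?case
    by (simp add: sum.nat_ivl_Suc' less_Suc_eq)
qed simp

lemma dvd_chain:
  fixes n :: "nat \<Rightarrow> nat"
  assumes "p \<le> k" and "\<And>k'. p \<le> k' \<Longrightarrow> k' < k \<Longrightarrow> n k' dvd n (Suc k')"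
  shows "n p dvd n k"
  using assms by (induction k rule: dec_induct) (auto intro: dvd_trans)

lemma sum_blocks:
  fixes e :: "nat \<Rightarrow> nat" and f :: "nat \<Rightarrow> 'a::comm_monoid_add"
  assumes "mono e" and "finite F" and "F \<subseteq> {Suc (e 0)..e N}"
  shows "(\<Sum>k\<in>F. f k) = (\<Sum>i=1..N. \<Sum>k\<in>F \<inter> {Suc (e (i - 1))..e i}. f k)"
  using assms(2,3)
proof (induction N arbitrary: F)
  case (Suc N)
  have *: "F \<inter> {Suc (e 0)..e N} \<inter> {Suc (e (i - 1))..e i} = F \<inter> {Suc (e (i - 1))..e i}"
    if "i \<in> {1..N}" for i
    using monoD[OF assms(1), of i N] monoD[OF assms(1), of 0 "i - 1"] that by auto
  have "F = (F \<inter> {Suc (e 0)..e N}) \<union> (F \<inter> {Suc (e N)..e (Suc N)})"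
    using Suc.prems(2) by auto
  then have "(\<Sum>k\<in>F. f k) = (\<Sum>k\<in>F \<inter> {Suc (e 0)..e N}. f k) + (\<Sum>k\<in>F \<inter> {Suc (e N)..e (Suc N)}. f k)"
    using Suc.prems(1) by (subst sum.union_disjoint[symmetric]) auto
  also have "(\<Sum>k\<in>F \<inter> {Suc (e 0)..e N}. f k)
      = (\<Sum>i=1..N. \<Sum>k\<in>F \<inter> {Suc (e 0)..e N} \<inter> {Suc (e (i - 1))..e i}. f k)"
    using Suc.prems by (intro Suc.IH) auto
  also have "\<dots> = (\<Sum>i=1..N. \<Sum>k\<in>F \<inter> {Suc (e (i - 1))..e i}. f k)"
    by (intro sum.cong[OF refl]) (simp only: *)
  finally show ?case
    by simp
qed simp

section \<open>Estimates for the degrees \<open>a (Suc i) div (4 * a i)\<close>\<close>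

lemma deg_quarter_bound:
  fixes a :: "nat \<Rightarrow> nat"
  assumes pos: "\<And>i. i \<ge> 1 \<Longrightarrow> a i > 0" and less: "\<And>i. i \<ge> 1 \<Longrightarrow> a i < a (Suc i)"
  shows "2 * (\<Sum>j=1..k. a (Suc j) div (4 * a j) * a j) + 1 \<le> a (Suc k)"
proof (induction k)
  case 0
  show ?case using pos[of 1] by simp
next
  case (Suc k)
  let ?d = "a (Suc (Suc k)) div (4 * a (Suc k))"
  show ?case
  proof (cases "?d = 0")
    case True
    then show ?thesis
      using Suc.IH less[of "Suc k"] by simp
  next
    case False
    \<comment> \<open>A nonzero degree adds at most half of \<open>a (Suc (Suc k))\<close> to the
      left side. It also forces \<open>a (Suc k)\<close>, which bounds the earlier part, to be at
      most a quarter of it.\<close>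
    have "4 * (?d * a (Suc k)) \<le> a (Suc (Suc k))"
      using div_times_less_eq_dividend[of "a (Suc (Suc k))" "4 * a (Suc k)"] by (simp add: mult_ac)
    moreover have "1 * a (Suc k) \<le> ?d * a (Suc k)"
      using False by (intro mult_right_mono) auto
    moreover have "(\<Sum>j=1..Suc k. a (Suc j) div (4 * a j) * a j)
        = (\<Sum>j=1..k. a (Suc j) div (4 * a j) * a j) + ?d * a (Suc k)"
      by simp
    ultimately show ?thesis
      using Suc.IH by linarith
  qed
qed

text \<open>Passing from \<open>k\<close> to \<open>Suc k\<close> multiplies the quotient by
  \<open>(2 * ?d + 1) * a (Suc k) / a (Suc (Suc k))\<close>, which is eventually at most
  \<open>1 / 2 + 1 / 4\<close>.\<close>

lemma sparse_quarter:
  fixes a :: "nat \<Rightarrow> nat"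
  assumes pos: "\<And>i. i \<ge> 1 \<Longrightarrow> a i > 0"
    and growth: "\<And>i. i \<ge> K \<Longrightarrow> 4 * a (Suc i) \<le> a (Suc (Suc i))"
  shows "(\<lambda>k. real (\<Prod>j=1..k. 2 * (a (Suc j) div (4 * a j)) + 1) / real (a (Suc k))) \<longlonglongrightarrow> 0"
    (is "?R \<longlonglongrightarrow> 0")
proof (rule summable_LIMSEQ_zero, rule summable_ratio_test[of "3 / 4" K])
  fix k
  assume "k \<ge> K"
  let ?d = "a (Suc (Suc k)) div (4 * a (Suc k))"
  have "4 * (?d * a (Suc k)) \<le> a (Suc (Suc k))"
    using div_times_less_eq_dividend[of "a (Suc (Suc k))" "4 * a (Suc k)"] by (simp add: mult_ac)
  then have "4 * ((2 * ?d + 1) * a (Suc k)) \<le> 3 * a (Suc (Suc k))"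
    using growth[OF \<open>k \<ge> K\<close>] by (simp add: algebra_simps)
  then have "4 * (real (2 * ?d + 1) * real (a (Suc k))) \<le> 3 * real (a (Suc (Suc k)))"
    by (metis of_nat_le_iff of_nat_mult of_nat_numeral)
  then have *: "real (2 * ?d + 1) / real (a (Suc (Suc k))) \<le> 3 / 4 / real (a (Suc k))"
    using pos[of "Suc k"] pos[of "Suc (Suc k)"] by (simp add: field_simps)
  have nonneg: "?R k \<ge> 0" for k
    by (intro divide_nonneg_nonneg of_nat_0_le_iff)
  have "?R (Suc k) = real (\<Prod>j=1..k. 2 * (a (Suc j) div (4 * a j)) + 1)
      * (real (2 * ?d + 1) / real (a (Suc (Suc k))))"
    by (simp add: distrib_left)
  also have "\<dots> \<le> real (\<Prod>j=1..k. 2 * (a (Suc j) div (4 * a j)) + 1) * (3 / 4 / real (a (Suc k)))"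
    using * by (rule mult_left_mono) (rule of_nat_0_le_iff)
  also have "\<dots> = 3 / 4 * ?R k"
    by simp
  finally show "norm (?R (Suc k)) \<le> 3 / 4 * norm (?R k)"
    using nonneg[of k] nonneg[of "Suc k"] by (simp only: real_norm_def abs_of_nonneg)
qed simp

text \<open>Rounding in both divisions costs only \<open>b \<le> 8 * a * h\<close> for the kernel
  parameter \<open>h\<close>, hence \<open>m / h \<le> 16 * \<rho>\<close>; the constant is
  \<open>8 * 16 ^ 2\<close>.\<close>

lemma jackson_coeff_quarter_ge:
  fixes a b m :: nat
  assumes "a > 0" and "\<rho> \<ge> 0" and "real m * real a \<le> 2 * \<rho> * real b"
  shows "1 - jackson_coeff (b div (4 * a) div 2 + 1) (int m) \<le> 2048 * \<rho>\<^sup>2"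
proof -
  let ?h = "b div (4 * a) div 2 + 1"
  have "b < 4 * a * (b div (4 * a) + 1)"
    using dividend_less_div_times[of "4 * a" b] assms(1) by (simp add: algebra_simps)
  also have "\<dots> \<le> 4 * a * (2 * ?h)"
    by (intro mult_left_mono) auto
  finally have "b \<le> 8 * a * ?h"
    by simp
  then have "real b \<le> real (8 * a * ?h)"
    by (rule of_nat_mono)
  then have b: "real b \<le> 8 * real a * real ?h"
    by (simp only: of_nat_mult of_nat_numeral)
  have "real m * real a \<le> 2 * \<rho> * (8 * real a * real ?h)"
    using assms(3) mult_left_mono[OF b, of "2 * \<rho>"] assms(2) by linarith
  also have "\<dots> = 16 * \<rho> * real ?h * real a"
    by simp
  finally have "real m \<le> 16 * \<rho> * real ?h"
    using assms(1) by simp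
  then have "real m / real ?h \<le> 16 * \<rho>"
    by (subst pos_divide_le_eq) auto
  then have "(real m / real ?h)\<^sup>2 \<le> (16 * \<rho>)\<^sup>2"
    by (intro power_mono) auto
  then show ?thesis
    using jackson_coeff_ge[of ?h "int m"] by (simp add: power_mult_distrib)
qed

section \<open>Construction of the Riesz product from the blocks, and its two properties\<close>

theorem theorem1p4:
  fixes n :: "nat \<Rightarrow> nat" and S :: "nat set"
  assumes "strict_mono_on {1..} n"
    and "\<forall>k\<ge>1. n k > 0"
    and "S \<subseteq> {1..}"
    and "infinite S"
    and "(\<lambda>k. (real (n k) / real (n (Suc k)))\<^sup>2) summable_on S"
    and "\<forall>k\<in>{1..} - S. n k dvd n (Suc k)"
  shows "\<exists>\<sigma>. generalized_riesz_product \<sigma> \<and> continuous_measure \<sigma> \<and> IP_Dirichlet \<sigma> n"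
proof -
  define e where "e = enumerate S"
  have e_strict: "strict_mono e"
    unfolding e_def by (rule strict_mono_enumerate[OF assms(4)])
  have e_ge_1: "e i \<ge> 1" for i
    using enumerate_in_set[OF assms(4), of i] assms(3) by (auto simp: e_def)
  have gap: "k \<notin> S" if "e i < k" "k < e (Suc i)" for i k
    using that not_less_Least[of k "\<lambda>s. s \<in> S \<and> enumerate S i < s"] enumerate_Suc''[OF assms(4), of i]
    by (auto simp: e_def)
  have n_less: "n j < n k" if "1 \<le> j" "j < k" for j k
    using strict_mono_onD[OF assms(1), of j k] that by auto
  have n_le: "n j \<le> n k" if "1 \<le> j" "j \<le> k" for j k
    using n_less[of j k] that by (cases "j = k") auto
  \<comment> \<open>the blocks \<open>{Suc (e (i - 1))..e i}\<close> are divisibility chains starting at \<open>a i\<close>; the indices up to \<open>e 0\<close>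
    and the value \<open>a 0\<close> play no role\<close>
  define a where "a i = n (Suc (e (i - 1)))" for i
  define d where "d i = a (Suc i) div (4 * a i)" for i
  \<comment> \<open>The largest \<open>h\<close> with \<open>2 * (h - 1) \<le> d i\<close>. It stays
    positive when \<open>d i = 0\<close>, and then the factor is the constant
    \<open>1\<close>.\<close>
  define h where "h i = d i div 2 + 1" for i
  define c where "c i m = complex_of_real (jackson_coeff (h i) m)" for i m
  define \<rho> where "\<rho> i = real (n (e i)) / real (n (Suc (e i)))" for i
  have a_gt_0: "a i > 0" for i
    using assms(2) by (simp add: a_def)
  have a_mono: "strict_mono_on {1..} a"
  proof (rule strict_mono_onI)
    fix i j :: nat
    assume "i \<in> {1..}" "i < j"
    then have "e (i - 1) < e (j - 1)"
      by (intro strict_monoD[OF e_strict]) auto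
    then show "a i < a j"
      unfolding a_def by (intro n_less) auto
  qed
  have dissociate: "2 * (\<Sum>j=1..k. d j * a j) + 1 \<le> a (Suc k)" for k
    unfolding d_def using a_gt_0 strict_mono_onD[OF a_mono]
    by (intro deg_quarter_bound) auto
  have trig_nonneg: "trig_poly (d k) (c k) z \<in> \<real>\<^sub>\<ge>\<^sub>0" if "z \<in> sphere 0 1" for k z
    unfolding c_def by (rule trig_poly_jackson_nonneg) (use that in \<open>auto simp: h_def\<close>)
  have c_0: "c k 0 = 1" for k
    by (simp add: c_def h_def jackson_coeff_0)
  have dissociate': "int (a (Suc k)) - 2 * (\<Sum>j=1..k. int (d j) * int (a j)) \<ge> 1" for k
    using dissociate[of k] by (simp flip: of_nat_mult of_nat_sum)
  interpret dissociated_riesz d c a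
    by unfold_locales (use trig_nonneg c_0 a_mono a_gt_0 dissociate' in auto)
  obtain \<sigma> where \<sigma>: "circle_prob \<sigma>" "circle_weak_star_limit (riesz_partial d c a) \<sigma>"
    and \<sigma>_coeff: "\<And>K n. 2 * \<bar>n\<bar> \<le> int (a (Suc K)) \<Longrightarrow> fourier_coeff \<sigma> n = coeff K n"
    using riesz_product_exists by blast
  have "generalized_riesz_product \<sigma>"
    unfolding generalized_riesz_product_def
    using \<sigma> trig_nonneg c_0 a_mono a_gt_0 dissociate' by blast
  have a_Suc: "a (Suc i) = n (Suc (e i))" for i
    by (simp add: a_def)
  have \<rho>_nonneg: "\<rho> i \<ge> 0" for i
    by (simp add: \<rho>_def)
  have \<rho>_eq: "real (n (e i)) = \<rho> i * real (a (Suc i))" for i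
    using a_gt_0[of "Suc i"] by (simp add: \<rho>_def a_Suc)
  have "summable (\<lambda>i. (\<rho> i)\<^sup>2)"
  proof -
    have "inj e" and "range e = S"
      using e_strict range_enumerate[OF assms(4)] by (auto simp: e_def strict_mono_imp_inj_on)
    then have "((\<lambda>k. (real (n k) / real (n (Suc k)))\<^sup>2) \<circ> e) summable_on UNIV"
      using assms(5) by (subst summable_on_reindex[symmetric]) auto
    then show ?thesis
      by (subst summable_on_UNIV_nonneg_real_iff[symmetric]) (auto simp: \<rho>_def comp_def)
  qed
  have "\<rho> \<longlonglongrightarrow> 0"
    using tendsto_real_sqrt[OF summable_LIMSEQ_zero[OF \<open>summable (\<lambda>i. (\<rho> i)\<^sup>2)\<close>]] \<rho>_nonneg
    by simp
  then have "\<forall>\<^sub>F i in sequentially. \<rho> i < 1 / 8"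
    by (rule order_tendstoD) simp
  \<comment> \<open>The threshold \<open>1 / 8\<close> makes twice the last term of a block at most
    a quarter of the next \<open>a (Suc i)\<close>, so that the digits fit under
    \<open>d i\<close>.\<close>
  then obtain I where I: "\<And>i. i \<ge> I \<Longrightarrow> \<rho> i < 1 / 8"
    by (auto simp: eventually_sequentially)
  have n_small: "8 * n (e i) \<le> a (Suc i)" if "i \<ge> I" for i
  proof -
    have "real (n (e i)) \<le> 1 / 8 * real (a (Suc i))"
      unfolding \<rho>_eq using I[OF that] by (intro mult_right_mono) auto
    then show ?thesis by linarith
  qed
  have "continuous_measure \<sigma>"
  proof (rule continuous_measure_if_sparse[OF \<sigma>(1) \<sigma>_coeff])
    show "(\<lambda>k. real (\<Prod>j=1..k. 2 * d j + 1) / real (a (Suc k))) \<longlonglongrightarrow> 0"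
      unfolding d_def
    proof (rule sparse_quarter[of a I])
      fix i
      assume "i \<ge> I"
      \<comment> \<open>The first term of a block is at most its last one, which is small compared
        with the first term of the following block.\<close>
      have "a (Suc i) \<le> n (e (Suc i))"
        unfolding a_Suc using strict_monoD[OF e_strict, of i "Suc i"] by (intro n_le) auto
      then show "4 * a (Suc i) \<le> a (Suc (Suc i))"
        using n_small[of "Suc i"] \<open>i \<ge> I\<close> by linarith
    qed (rule a_gt_0)
  qed
  have "IP_Dirichlet \<sigma> n"
    unfolding IP_Dirichlet_def
  proof (intro allI impI)
    fix \<epsilon> :: real
    assume "\<epsilon> > 0"
    then obtain M where M: "\<And>m N. m \<ge> M \<Longrightarrow> norm (\<Sum>i\<in>{m..<N}. (\<rho> i)\<^sup>2) < \<epsilon> / 2048"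
      using \<open>summable (\<lambda>i. (\<rho> i)\<^sup>2)\<close> unfolding summable_Cauchy
      by (meson divide_pos_pos zero_less_numeral)
    \<comment> \<open>Past \<open>I\<close> the digits fit, past \<open>M\<close> the tail is small;
      \<open>Suc\<close> makes \<open>i0 - 1\<close> a genuine predecessor.\<close>
    define i0 where "i0 = Suc (max I M)"
    show "\<exists>k0. \<forall>F. finite F \<and> F \<noteq> {} \<and> F \<subseteq> {1..} \<and> Min F \<ge> k0 \<longrightarrow>
        cmod (fourier_coeff \<sigma> (int (\<Sum>k\<in>F. n k)) - 1) < \<epsilon>"
    proof (intro exI allI impI)
      fix F
      \<comment> \<open>The witness for \<open>k0\<close> is the first index of block
        \<open>i0\<close>.\<close>
      assume "finite F \<and> F \<noteq> {} \<and> F \<subseteq> {1..} \<and> Min F \<ge> Suc (e (i0 - 1))"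
      then have F: "finite F" and Min: "Suc (e (i0 - 1)) \<le> Min F"
        by blast+
      have F_gt: "k > e (i0 - 1)" if "k \<in> F" for k
        using Min Min_le[OF F that] by linarith
      define N where "N = Max F"
      \<comment> \<open>the \<open>m i\<close> are the digits of \<open>\<Sum>k\<in>F. n k\<close> with respect to the \<open>a i\<close>\<close>
      define s where "s i = (\<Sum>k\<in>F \<inter> {Suc (e (i - 1))..e i}. n k)" for i
      define m where "m i = s i div a i" for i
      have F_sub: "F \<subseteq> {Suc (e 0)..e N}"
      proof
        fix k
        assume "k \<in> F"
        then have "k \<le> N"
          using F by (simp add: N_def)
        also have "N \<le> e N"
          using e_strict by (rule strict_mono_imp_increasing)
        finally show "k \<in> {Suc (e 0)..e N}"
          using F_gt[OF \<open>k \<in> F\<close>] strict_mono_less_eq[OF e_strict, of 0 "i0 - 1"] by auto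
      qed
      \<comment> \<open>Inside a block only its last index \<open>e i\<close> lies in
        \<open>S\<close>. For \<open>i = 0\<close> the range is empty, as
        \<open>0 - 1 = 0\<close>.\<close>
      have block: "n k dvd n (Suc k)" if "Suc (e (i - 1)) \<le> k" "k < e i" for i k
        using that assms(6) gap[of "i - 1" k] by (cases i) auto
      have a_dvd: "a i dvd s i" for i
        unfolding s_def a_def by (rule dvd_sum, rule dvd_chain) (auto intro: block)
      have s_eq: "s i = m i * a i" for i
        unfolding m_def using dvd_div_mult_self[OF a_dvd] by (rule sym)
      have s_le: "s i \<le> 2 * n (e i)" if "i \<ge> 1" for i
      proof -
        have "s i \<le> (\<Sum>k=Suc (e (i - 1))..e i. n k)"
          unfolding s_def by (intro sum_mono2) auto
        also have "\<dots> \<le> 2 * n (e i)"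
        proof (rule sum_dvd_chain_le)
          show "Suc (e (i - 1)) \<le> e i"
            using that strict_monoD[OF e_strict, of "i - 1" i] by simp
          show "n k dvd n (Suc k) \<and> n k < n (Suc k)" if "Suc (e (i - 1)) \<le> k" "k < e i" for k
            using block[OF that] n_less[of k "Suc k"] that(1) by simp
        qed
        finally show ?thesis .
      qed
      have s_0: "s i = 0" if "i < i0" for i
      proof -
        have "e i \<le> e (i0 - 1)"
          using that by (subst strict_mono_less_eq[OF e_strict]) auto
        then have "F \<inter> {Suc (e (i - 1))..e i} = {}"
          using F_gt by fastforce
        then show ?thesis by (simp add: s_def)
      qed
      then have m_0: "m i = 0" if "i < i0" for i
        using that by (simp add: m_def)
      have m_le: "m i \<le> d i" if "i \<ge> 1" for i
      proof (cases "i < i0")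
        case False
        then have "i \<ge> I"
          by (simp add: i0_def)
        then have "4 * (m i * a i) \<le> a (Suc i)"
          using s_le[OF that] n_small[of i] by (simp add: s_eq)
        then show ?thesis
          unfolding d_def using a_gt_0[of i] by (simp add: less_eq_div_iff_mult_less_eq mult_ac)
      qed (simp add: m_0)
      have "mono e"
        using e_strict by (rule strict_mono_mono)
      have "int (\<Sum>k\<in>F. n k) = (\<Sum>i=1..N. int (m i) * int (a i))"
        using sum_blocks[OF \<open>mono e\<close> F F_sub, of n]
        by (simp only: s_def[symmetric] s_eq of_nat_sum[symmetric] of_nat_mult[symmetric])
      \<comment> \<open>This puts the frequency in the range where the limit measure has the
        coefficient of the \<open>N\<close>-th partial product.\<close>
      moreover have "2 * \<bar>\<Sum>i=1..N. int (m i) * int (a i)\<bar> \<le> int (a (Suc N))"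
      proof -
        have "(\<Sum>i=1..N. int (m i) * int (a i)) \<le> deg N"
          unfolding deg_def using m_le by (intro sum_mono mult_right_mono) auto
        moreover have "(\<Sum>i=1..N. int (m i) * int (a i)) \<ge> 0"
          by (intro sum_nonneg) auto
        ultimately show ?thesis
          using deg_less[of N] by linarith
      qed
      ultimately have "fourier_coeff \<sigma> (int (\<Sum>k\<in>F. n k)) = (\<Prod>i=1..N. c i (- int (m i)))"
        using \<sigma>_coeff coeff_sum[of N "\<lambda>i. int (m i)"] m_le by simp
      then have "cmod (fourier_coeff \<sigma> (int (\<Sum>k\<in>F. n k)) - 1)
          = norm ((\<Prod>i=1..N. c i (- int (m i))) - (\<Prod>i=1..N. 1))"
        by simp
      \<comment> \<open>All factors lie in the closed unit disc, so the difference of the products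
        telescopes.\<close>
      also have "\<dots> \<le> (\<Sum>i=1..N. norm (c i (- int (m i)) - 1))"
        by (intro norm_prod_diff)
          (auto simp: c_def h_def jackson_coeff_nonneg jackson_coeff_le_1)
      also have "\<dots> = (\<Sum>i=1..N. 1 - jackson_coeff (h i) (int (m i)))"
      proof (rule sum.cong)
        fix i
        have "c i (- int (m i)) - 1 = complex_of_real (jackson_coeff (h i) (int (m i)) - 1)"
          by (simp add: c_def jackson_coeff_minus)
        then show "norm (c i (- int (m i)) - 1) = 1 - jackson_coeff (h i) (int (m i))"
          using jackson_coeff_le_1[of "h i" "int (m i)"] by (simp only: norm_of_real) (simp add: h_def)
      qed simp
      \<comment> \<open>Blocks before \<open>i0\<close> do not meet \<open>F\<close>; their digit is
        \<open>0\<close> and their factor is \<open>1\<close>.\<close>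
      also have "\<dots> = (\<Sum>i\<in>{i0..<Suc N}. 1 - jackson_coeff (h i) (int (m i)))"
        by (rule sum.mono_neutral_right) (auto simp: m_0 h_def jackson_coeff_0 i0_def)
      also have "\<dots> \<le> (\<Sum>i\<in>{i0..<Suc N}. 2048 * (\<rho> i)\<^sup>2)"
      proof (rule sum_mono)
        fix i
        assume "i \<in> {i0..<Suc N}"
        then have "real (s i) \<le> 2 * real (n (e i))"
          using s_le[of i] by (simp add: i0_def)
        then have "real (m i) * real (a i) \<le> 2 * \<rho> i * real (a (Suc i))"
          by (simp add: s_eq \<rho>_eq)
        then show "1 - jackson_coeff (h i) (int (m i)) \<le> 2048 * (\<rho> i)\<^sup>2"
          unfolding h_def d_def by (rule jackson_coeff_quarter_ge[OF a_gt_0 \<rho>_nonneg])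
      qed
      also have "\<dots> < \<epsilon>"
      proof -
        have "i0 \<ge> M"
          by (simp add: i0_def)
        from M[OF this, of "Suc N"] have "(\<Sum>i\<in>{i0..<Suc N}. (\<rho> i)\<^sup>2) < \<epsilon> / 2048"
          unfolding real_norm_def by linarith
        then show ?thesis
          unfolding sum_distrib_left[symmetric] by linarith
      qed
      finally show "cmod (fourier_coeff \<sigma> (int (\<Sum>k\<in>F. n k)) - 1) < \<epsilon>" .
    qed
  qed
  with \<open>generalized_riesz_product \<sigma>\<close> \<open>continuous_measure \<sigma>\<close> show ?thesis
    by blast
qed

end
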